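(* Let $(R_n)_{n\ge1}$ be a sequence of probability distributions on $\mathbb{R}\times\mathbb{R}$ converging weakly to a probability distribution $R$, and suppose that all $R_n$ (and thus $R$) are stochastically ordered. For each $n$ let $K_n$ be a stochastic kernel for $R_n$ that is isotonic with respect to stochastic order on the range $\mathcal{X}_n$ of $R_n$, and for $\beta\in(0,1)$ and $x\in\mathbb{R}$ let $q_n(\beta\,|\,x)$ be some real number $y$ such that $K_n(x,(-\infty,y))\le\beta\le K_n(x,(-\infty,y])$. Then for any $\beta\in(0,1)$ and arbitrary interior points $x_1<x_2$ of the range $\mathcal{X}$ of $R$, \[ \liminf_{n\to\infty} q_n(\beta\,|\,x_2)\ \ge\ q^{\rm w}(\beta\,|\,x_1), \qquad \limsup_{n\to\infty} q_n(\beta\,|\,x_1)\ \le\ q^{\rm e}(\beta\,|\,x_2). \]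
   Context: For a probability distribution $R$ on $\mathbb{R}\times\mathbb{R}$ let $P=R(\cdot\times\mathbb{R})$ be its first marginal, and let its range be $\mathcal{X}:=\{x\in\mathbb{R}:P((-\infty,x])>0,\ P([x,\infty))>0\}$; $\mathcal{X}_n$ and $P_n$ are the same objects for $R_n$. $R$ is called stochastically ordered if $R(A_1\times(y,\infty))P(A_2)\le P(A_1)R(A_2\times(y,\infty))$ for all $y\in\mathbb{R}$ and all Borel sets $A_1,A_2$ with $a_1<a_2$ for all $a_1\in A_1,a_2\in A_2$. A stochastic kernel for $R$ is a map $K:\mathbb{R}\times\mathcal{B}\to[0,1]$ ($\mathcal{B}$ the Borel $\sigma$-field of $\mathbb{R}$) such that each $K(x,\cdot)$ is a probability measure, each $K(\cdot,B)$ is measurable, and $R(A\times B)=\int_A K(x,B)\,P(\mathrm{d}x)$ for all $A,B\in\mathcal{B}$. It is isotonic with respect to stochastic order on $\mathcal{X}$ if $K(x_1,(y,\infty))\le K(x_2,(y,\infty))$ for all $y\in\mathbb{R}$ and $x_1<x_2$ in $\mathcal{X}$. Being stochastically ordered is equivalent to the existence of such a kernel. Extremal kernels of a stochastically ordered $R$: for $x\in\mathcal{X}$, $K^{\rm w}(x,\cdot)$ and $K^{\rm e}(x,\cdot)$ are the probability measures on $\mathbb{R}$ given by $K^{\rm w}(x,(y,\infty)):=\sup\{R((a,x]\times(y,\infty))/P((a,x]) : a<x,\ P((a,x])>0\}$ and $K^{\rm e}(x,(-\infty,y)):=\sup\{R([x,b)\times(-\infty,y))/P([x,b)) : b>x,\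 P([x,b))>0\}$ for $y\in\mathbb{R}$. Their extremal quantiles are $q^{\rm w}(\beta\,|\,x):=\min\{y\in\mathbb{R}:K^{\rm w}(x,(-\infty,y])\ge\beta\}$ and $q^{\rm e}(\beta\,|\,x):=\max\{y\in\mathbb{R}:K^{\rm e}(x,(-\infty,y))\le\beta\}$. *)

theory Defs
  imports "HOL-Probability.Probability"
begin

text \<open>
  Probability distributions on \<open>\<real> \<times> \<real>\<close> are Borel probability measures of type
  \<^typ>\<open>(real \<times> real) measure\<close>.
\<close>

definition marginal :: "(real \<times> real) measure \<Rightarrow> real measure" where
  "marginal R = distr R borel fst"

definition dist_range :: "(real \<times> real) measure \<Rightarrow> real set" where
  "dist_range R = {x. measure (marginal R) {..x} > 0 \<and> measure (marginal R) {x..} > 0}"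

definition stoch_ordered :: "(real \<times> real) measure \<Rightarrow> bool" where
  "stoch_ordered R \<longleftrightarrow>
    (\<forall>y. \<forall>A\<^sub>1\<in>sets borel. \<forall>A\<^sub>2\<in>sets borel. (\<forall>a\<^sub>1\<in>A\<^sub>1. \<forall>a\<^sub>2\<in>A\<^sub>2. a\<^sub>1 < a\<^sub>2) \<longrightarrow>
      measure R (A\<^sub>1 \<times> {y<..}) * measure (marginal R) A\<^sub>2
        \<le> measure (marginal R) A\<^sub>1 * measure R (A\<^sub>2 \<times> {y<..}))"

definition stoch_kernel :: "(real \<times> real) measure \<Rightarrow> (real \<Rightarrow> real measure) \<Rightarrow> bool" where
  "stoch_kernel R K \<longleftrightarrow>
    K \<in> borel \<rightarrow>\<^sub>M prob_algebra borel \<and>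
    (\<forall>A\<in>sets borel. \<forall>B\<in>sets borel.
      measure R (A \<times> B) = (LINT x:A|marginal R. measure (K x) B))"

definition isotonic_on :: "real set \<Rightarrow> (real \<Rightarrow> real measure) \<Rightarrow> bool" where
  "isotonic_on X K \<longleftrightarrow>
    (\<forall>y. \<forall>x\<^sub>1\<in>X. \<forall>x\<^sub>2\<in>X. x\<^sub>1 < x\<^sub>2 \<longrightarrow> measure (K x\<^sub>1) {y<..} \<le> measure (K x\<^sub>2) {y<..})"

text \<open>
  The extremal kernels are the unique Borel probability measures with the prescribed tails.
  They exist for stochastically ordered \<open>R\<close> and \<open>x\<close> in the range of \<open>R\<close>; for other
  arguments the values are unspecified.
\<close>

definition kernel_w :: "(real \<times> real) measure \<Rightarrow> real \<Rightarrow> real measure" where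
  "kernel_w R x = (THE M. prob_space M \<and> sets M = sets borel \<and>
    (\<forall>y. measure M {y<..} =
      Sup {measure R ({a<..x} \<times> {y<..}) / measure (marginal R) {a<..x} | a.
             a < x \<and> measure (marginal R) {a<..x} > 0}))"

definition kernel_e :: "(real \<times> real) measure \<Rightarrow> real \<Rightarrow> real measure" where
  "kernel_e R x = (THE M. prob_space M \<and> sets M = sets borel \<and>
    (\<forall>y. measure M {..<y} =
      Sup {measure R ({x..<b} \<times> {..<y}) / measure (marginal R) {x..<b} | b.
             b > x \<and> measure (marginal R) {x..<b} > 0}))"

definition quantile_w :: "(real \<times> real) measure \<Rightarrow> real \<Rightarrow> real \<Rightarrow> real" where
  "quantile_w R \<beta> x = (LEAST y. measure (kernel_w R x) {..y} \<ge> \<beta>)"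

definition quantile_e :: "(real \<times> real) measure \<Rightarrow> real \<Rightarrow> real \<Rightarrow> real" where
  "quantile_e R \<beta> x = (GREATEST y. measure (kernel_e R x) {..<y} \<le> \<beta>)"

text \<open>
  The library's \<^const>\<open>weak_conv_m\<close> is restricted to measures on the real line, so weak
  convergence is defined here by means of bounded continuous test functions.
\<close>

definition weakly_converges :: "(nat \<Rightarrow> 'a::topological_space measure) \<Rightarrow> 'a measure \<Rightarrow> bool" where
  "weakly_converges M N \<longleftrightarrow>
    (\<forall>f :: 'a \<Rightarrow> real. continuous_on UNIV f \<longrightarrow> bounded (range f) \<longrightarrow>
      (\<lambda>n. integral\<^sup>L (M n) f) \<longlonglongrightarrow> integral\<^sup>L N f)"

end

theory Submission
  imports Defs
begin

text \<open>
  Stochastic order passes to the weak limit because it suffices to test it on disjoint compact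
  sets; these have a gap, so they can be enlarged slightly to continuity sets of \<open>R\<close>.

  Lower bound: if \<open>c < q\<^sup>w(\<beta> | x\<^sub>1)\<close>, then \<open>R((a, x\<^sub>1] \<times> (c, \<infinity>)) > (1 - \<beta>) P((a, x\<^sub>1])\<close> for some
  \<open>a < x\<^sub>1\<close>. Moving \<open>a\<close> and \<open>x\<^sub>1\<close> slightly to the right yields a continuity interval
  \<open>J \<subseteq> (-\<infinity>, x\<^sub>2)\<close> for which the strict inequality survives, and by the portmanteau theorem it holds
  for \<open>R\<^sub>n\<close> with \<open>n\<close> large. By isotonicity \<open>R\<^sub>n(J \<times> (c, \<infinity>)) \<le> K\<^sub>n(x\<^sub>2, (c, \<infinity>)) P\<^sub>n(J)\<close>, whence
  \<open>K\<^sub>n(x\<^sub>2, (-\<infinity>, c]) < \<beta>\<close> and \<open>q\<^sub>n(\<beta> | x\<^sub>2) > c\<close>.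

  Upper bound: the reflection \<open>z \<mapsto> -z\<close> of the plane exchanges the two extremal kernels and turns
  \<open>\<beta>\<close> into \<open>1 - \<beta>\<close>.
\<close>

section \<open>Measures and weak convergence\<close>

text \<open>No interval \<open>{0<..<inverse (real (Suc k))}\<close> fits into a countable set. In
  the applications \<open>S\<close> collects the levels charged by \<open>R\<close>, so that shifts
  by \<open>d k\<close> produce continuity sets.\<close>

lemma countable_avoiding_null_sequence:
  fixes S :: "real set"
  assumes "countable S"
  obtains d :: "nat \<Rightarrow> real" where "\<And>k. 0 < d k" "\<And>k. d k \<notin> S" "d \<longlonglongrightarrow> 0"
proof -
  have "\<exists>t. 0 < t \<and> t < inverse (real (Suc k)) \<and> t \<notin> S" for k
  proof (rule ccontr)
    assume "\<nexists>t. 0 < t \<and> t < inverse (real (Suc k)) \<and> t \<notin> S"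
    then have "{0<..<inverse (real (Suc k))} \<subseteq> S" by auto
    then show False
      using assms countable_subset uncountable_open_interval[of 0 "inverse (real (Suc k))"] by auto
  qed
  then obtain d where d: "\<And>k. 0 < d k" "\<And>k. d k < inverse (real (Suc k))" "\<And>k. d k \<notin> S"
    by metis
  have "d \<longlonglongrightarrow> 0"
    by (rule tendsto_sandwich[OF _ _ tendsto_const LIMSEQ_inverse_real_of_nat])
       (use d in \<open>auto intro!: always_eventually less_imp_le simp del: of_nat_Suc\<close>)
  with d that show ?thesis by blast
qed

text \<open>Pointwise convergence of the indicators of \<open>{y + d k<..}\<close>, in the form
  required by \<open>measure_tendsto_eventually\<close>.\<close>

lemma null_sequence_add_less:
  fixes d :: "nat \<Rightarrow> real"
  assumes "\<And>k. 0 < d k" "d \<longlonglongrightarrow> 0"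
  shows "eventually (\<lambda>k. y + d k < t \<longleftrightarrow> y < t) sequentially"
proof (cases "y < t")
  case True
  then have "eventually (\<lambda>k. d k < t - y) sequentially"
    using assms(2) by (intro order_tendstoD(2)) auto
  then show ?thesis by eventually_elim (use True in auto)
next
  case False
  then have "\<not> y + d k < t" for k
    using assms(1)[of k] by linarith
  then show ?thesis using False by simp
qed

text \<open>Because \<open>d k\<close> is positive, the strict inequality becomes non-strict in the
  limit: an open right endpoint that moves down to \<open>y\<close> leaves a closed one.\<close>

lemma null_sequence_less_add:
  fixes d :: "nat \<Rightarrow> real"
  assumes "\<And>k. 0 < d k" "d \<longlonglongrightarrow> 0"
  shows "eventually (\<lambda>k. t < y + d k \<longleftrightarrow> t \<le> y) sequentially"
proof (cases "t \<le> y")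
  case True
  then have "t < y + d k" for k
    using assms(1)[of k] by linarith
  then show ?thesis using True by simp
next
  case False
  then have "eventually (\<lambda>k. d k < t - y) sequentially"
    using assms(2) by (intro order_tendstoD(2)) auto
  then show ?thesis by eventually_elim (use False in auto)
qed

section \<open>Convergence of masses and charged levels under a finite measure\<close>

context finite_measure
begin

text \<open>Dominated convergence for indicators, with the constant 1 as majorant.\<close>

lemma measure_tendsto_eventually:
  assumes [measurable]: "\<And>k. A k \<in> sets M" "B \<in> sets M"
    and ev: "\<And>x. x \<in> space M \<Longrightarrow> eventually (\<lambda>k. x \<in> A k \<longleftrightarrow> x \<in> B) sequentially"
  shows "(\<lambda>k. measure M (A k)) \<longlonglongrightarrow> measure M B"
proof -
  have "(\<lambda>k. \<integral>x. indicator (A k) x \<partial>M) \<longlonglongrightarrow> (\<integral>x. indicator B x \<partial>M :: real)"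
  proof (rule integral_dominated_convergence[where w="\<lambda>_. 1"])
    show "AE x in M. (\<lambda>k. indicator (A k) x :: real) \<longlonglongrightarrow> indicator B x"
      by (rule AE_I2, rule tendsto_eventually, rule eventually_mono[OF ev])
         (auto simp: indicator_def)
  qed (auto simp: indicator_def)
  then show ?thesis
    by simp
qed

text \<open>The charged levels of \<open>f\<close> are the atoms of its image law, and a finite
  measure has only countably many atoms.\<close>

lemma countable_level_support:
  fixes f :: "'a \<Rightarrow> real"
  assumes [measurable]: "f \<in> borel_measurable M"
  shows "countable {t. measure M {x \<in> space M. f x = t} \<noteq> 0}"
proof -
  interpret D: finite_measure "distr M borel f"
    by (rule finite_measure_distr) simp
  have "measure (distr M borel f) {t} = measure M {x \<in> space M. f x = t}" for t
    by (subst measure_distr) (auto intro!: arg_cong[of _ _ "measure M"])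
  then show ?thesis
    using D.countable_support by simp
qed

end

text \<open>Portmanteau lower bound for open sets: \<open>U\<close> is approximated from below by
  continuous functions of the distance to its complement, and one of them already has integral above
  \<open>c\<close>.\<close>

lemma weakly_converges_open:
  fixes M :: "nat \<Rightarrow> 'a::metric_space measure"
  assumes "\<And>n. prob_space (M n)" "\<And>n. sets (M n) = sets borel"
    and "prob_space N" "sets N = sets borel"
    and conv: "weakly_converges M N"
    and U: "open U" and c: "c < measure N U"
  shows "eventually (\<lambda>n. c < measure (M n) U) sequentially"
\<comment> \<open>The complement of \<open>UNIV\<close> is empty and \<open>infdist x {}\<close> is
  0 by convention, so the functions \<open>f k\<close> below would vanish in this case.\<close>
proof (cases "U = UNIV")
  case True
  have "measure (M n) U = 1" "measure N U = 1" for n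
    using assms True prob_space.prob_space sets_eq_imp_space_eq[of _ borel]
    by (metis space_borel)+
  then show ?thesis using c by simp
next
  case False
  note [measurable_cong] = assms(2,4)
  interpret N: prob_space N by fact
  have [measurable]: "U \<in> sets borel" using U by simp
  define f where "f k x = min 1 (real k * infdist x (-U))" for k x
  have f_cont: "continuous_on UNIV (f k)" for k
    unfolding f_def by (intro continuous_intros)
  then have [measurable]: "f k \<in> borel_measurable borel" for k
    by (rule borel_measurable_continuous_onI)
  have f01: "0 \<le> f k x" "f k x \<le> 1" for k x
    by (auto simp: f_def infdist_nonneg)
  have f_le: "f k x \<le> indicator U x" for k x
    using f01[of k x] by (auto simp: indicator_def f_def)
  have lim: "(\<lambda>k. f k x) \<longlonglongrightarrow> indicator U x" for x
  proof (cases "x \<in> U")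
    case True
    then have pos: "infdist x (-U) > 0"
      using U False by (intro infdist_pos_not_in_closed) auto
    have "eventually (\<lambda>k. 1 / infdist x (-U) \<le> real k) sequentially"
      using eventually_ge_at_top[of "nat \<lceil>1 / infdist x (-U)\<rceil>"]
      by eventually_elim linarith
    then have "eventually (\<lambda>k. f k x = indicator U x) sequentially"
      by eventually_elim (use pos True in \<open>simp add: f_def divide_simps\<close>)
    then show ?thesis by (rule tendsto_eventually)
  next
    case False
    then show ?thesis by (simp add: f_def)
  qed
  have "(\<lambda>k. integral\<^sup>L N (f k)) \<longlonglongrightarrow> (\<integral>x. indicator U x \<partial>N)"
    by (rule integral_dominated_convergence[where w="\<lambda>_. 1"]) (auto simp: lim f01)
  then have "eventually (\<lambda>k. c < integral\<^sup>L N (f k)) sequentially"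
    using c by (intro order_tendstoD(1)) auto
  then obtain k where k: "c < integral\<^sup>L N (f k)"
    by (auto dest: eventually_happens)
  have "bounded (range (f k))"
    by (rule boundedI[where B=1]) (use f01 in auto)
  then have "(\<lambda>n. integral\<^sup>L (M n) (f k)) \<longlonglongrightarrow> integral\<^sup>L N (f k)"
    using conv f_cont by (auto simp: weakly_converges_def)
  then have "eventually (\<lambda>n. c < integral\<^sup>L (M n) (f k)) sequentially"
    using k by (intro order_tendstoD(1)) auto
  then show ?thesis
  proof eventually_elim
    case (elim n)
    interpret Mn: prob_space "M n" by fact
    have "integral\<^sup>L (M n) (f k) \<le> (\<integral>x. indicator U x \<partial>M n)"
      by (intro integral_mono f_le Mn.integrable_const_bound[where B=1]) (auto simp: f01)
    with elim show ?case by simp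
  qed
qed

text \<open>The interior carries the whole mass of a set with null frontier, so the bound for open
  sets gives the lower estimate. The upper estimate is the lower one for the complement, which has
  the same frontier.\<close>

lemma weakly_converges_continuity_set:
  fixes M :: "nat \<Rightarrow> 'a::metric_space measure"
  assumes "\<And>n. prob_space (M n)" "\<And>n. sets (M n) = sets borel"
    and "prob_space N" "sets N = sets borel"
    and conv: "weakly_converges M N"
    and A: "A \<in> sets borel" and null: "measure N (frontier A) = 0"
  shows "(\<lambda>n. measure (M n) A) \<longlonglongrightarrow> measure N A"
proof -
  note op = weakly_converges_open[OF assms(1-5)]
  interpret N: prob_space N by fact
  interpret M: prob_space "M n" for n by fact
  have sp: "space N = UNIV" "space (M n) = UNIV" for n
    using assms(2,4) by (metis sets_eq_imp_space_eq space_borel)+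
  have less: "eventually (\<lambda>n. c < measure (M n) B) sequentially"
    if B: "B \<in> sets borel" and nB: "measure N (frontier B) = 0" and c: "c < measure N B" for B c
  proof -
    have "measure N B \<le> measure N (interior B \<union> frontier B)"
      using assms(4) closure_subset[of B]
      by (intro N.finite_measure_mono) (auto simp: frontier_def)
    also have "\<dots> \<le> measure N (interior B) + measure N (frontier B)"
      using assms(4) by (intro measure_subadditive) (auto simp: N.emeasure_eq_measure)
    finally have "eventually (\<lambda>n. c < measure (M n) (interior B)) sequentially"
      using c nB by (intro op) auto
    then show ?thesis
    proof eventually_elim
      case (elim n)
      have "measure (M n) (interior B) \<le> measure (M n) B"
        using assms(2) B interior_subset by (intro M.finite_measure_mono) auto
      with elim show ?case by simp
    qed
  qed
  show ?thesis
  proof (rule order_tendstoI)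
    fix c assume "c < measure N A"
    then show "eventually (\<lambda>n. c < measure (M n) A) sequentially"
      using less A null by blast
  next
    fix c assume "measure N A < c"
    moreover have "measure N (-A) = 1 - measure N A" "measure (M n) (-A) = 1 - measure (M n) A" for n
      using N.prob_compl[of A] M.prob_compl[of A n] A assms(2,4) by (auto simp: sp Compl_eq_Diff_UNIV)
    ultimately show "eventually (\<lambda>n. measure (M n) A < c) sequentially"
      using less[of "-A" "1 - c"] A null by (auto simp: frontier_complement)
  qed
qed

section \<open>Borel probability laws on the plane and their first marginals\<close>

locale plane_law = prob_space R for R :: "(real \<times> real) measure" +
  assumes sets_R [simp, measurable_cong]: "sets R = sets borel"
begin

lemma space_R [simp]: "space R = UNIV"
  using sets_R by (metis sets_eq_imp_space_eq space_borel)

lemma measure_marginal: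
  "A \<in> sets borel \<Longrightarrow> measure (marginal R) A = measure R (A \<times> UNIV)"
  unfolding marginal_def
  by (subst measure_distr) (auto intro!: arg_cong[of _ _ "measure R"] borel_measurable_continuous_onI continuous_on_fst
      simp: measurable_cong_sets[OF sets_R refl])

end

lemma Times_borel [simp, intro]:
  fixes A :: "'a::second_countable_topology set" and B :: "'b::second_countable_topology set"
  shows "A \<in> sets borel \<Longrightarrow> B \<in> sets borel \<Longrightarrow> A \<times> B \<in> sets borel"
  by (subst borel_prod[symmetric]) auto

section \<open>Stochastic order under weak limits\<close>

text \<open>With the marginal eliminated, all four factors are masses of rectangles, to which the
  limit lemmas for \<open>R\<close> apply directly.\<close>

lemma (in plane_law) stoch_ordered_iff:
  "stoch_ordered R \<longleftrightarrow>
    (\<forall>y. \<forall>A\<^sub>1\<in>sets borel. \<forall>A\<^sub>2\<in>sets borel. (\<forall>a\<^sub>1\<in>A\<^sub>1. \<forall>a\<^sub>2\<in>A\<^sub>2. a\<^sub>1 < a\<^sub>2) \<longrightarrow>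
      measure R (A\<^sub>1 \<times> {y<..}) * measure R (A\<^sub>2 \<times> UNIV)
        \<le> measure R (A\<^sub>1 \<times> UNIV) * measure R (A\<^sub>2 \<times> {y<..}))"
  unfolding stoch_ordered_def by (simp add: measure_marginal)

lemma (in plane_law) measure_Times_tendsto:
  assumes "\<And>k. A k \<in> sets borel" "\<And>k. B k \<in> sets borel" "A' \<in> sets borel" "B' \<in> sets borel"
    and "\<And>x. eventually (\<lambda>k. x \<in> A k \<longleftrightarrow> x \<in> A') sequentially"
    and "\<And>y. eventually (\<lambda>k. y \<in> B k \<longleftrightarrow> y \<in> B') sequentially"
  shows "(\<lambda>k. measure R (A k \<times> B k)) \<longlonglongrightarrow> measure R (A' \<times> B')"
proof (rule measure_tendsto_eventually)
  fix z :: "real \<times> real"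
  show "eventually (\<lambda>k. z \<in> A k \<times> B k \<longleftrightarrow> z \<in> A' \<times> B') sequentially"
    using assms(5)[of "fst z"] assms(6)[of "snd z"] by eventually_elim (auto simp: mem_Times_iff)
qed (use assms(1-4) in auto)

text \<open>The frontier of a rectangle lies in the union of the two strips over the frontiers of
  its sides.\<close>

lemma (in plane_law) measure_frontier_Times:
  assumes "measure R (frontier A \<times> UNIV) = 0" "measure R (UNIV \<times> frontier B) = 0"
  shows "measure R (frontier (A \<times> B)) = 0"
proof -
  have [simp]: "frontier A \<in> sets borel" "frontier B \<in> sets borel"
    by (simp_all add: frontier_closed borel_closed)
  have "frontier (A \<times> B) \<subseteq> frontier A \<times> UNIV \<union> UNIV \<times> frontier B"
    by (auto simp: frontier_def closure_Times interior_Times)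
  then have "measure R (frontier (A \<times> B)) \<le> measure R (frontier A \<times> UNIV \<union> UNIV \<times> frontier B)"
    by (intro finite_measure_mono) auto
  also have "\<dots> \<le> measure R (frontier A \<times> UNIV) + measure R (UNIV \<times> frontier B)"
    by (intro measure_subadditive) (auto simp: emeasure_eq_measure)
  finally show ?thesis
    using assms by (simp add: measure_le_0_iff)
qed

text \<open>Inner regularity is used for the marginal only. The error on \<open>A \<times> B\<close>
  is at most the marginal mass of \<open>A - C k\<close>, so one sequence \<open>C\<close> serves
  all \<open>B\<close> at once, in particular \<open>{y<..}\<close> and \<open>UNIV\<close>.\<close>

lemma (in plane_law) compact_inner_approximation:
  assumes A [simp]: "A \<in> sets borel"
  obtains C where "\<And>k :: nat. compact (C k)" "\<And>k. C k \<subseteq> A"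
    "\<And>B. B \<in> sets borel \<Longrightarrow> (\<lambda>k. measure R (C k \<times> B)) \<longlonglongrightarrow> measure R (A \<times> B)"
proof -
  have fst_meas: "fst \<in> R \<rightarrow>\<^sub>M borel"
    by (simp add: measurable_cong_sets[OF sets_R refl] borel_measurable_continuous_onI continuous_on_fst)
  interpret P: prob_space "marginal R"
    unfolding marginal_def by (rule prob_space_distr) (rule fst_meas)
  have sP: "sets (marginal R) = sets borel"
    by (simp add: marginal_def)
  have "\<exists>K. compact K \<and> K \<subseteq> A \<and> measure (marginal R) A - inverse (real (Suc k)) < measure (marginal R) K" for k
  proof -
    have "emeasure (marginal R) A = (SUP K \<in> {K. K \<subseteq> A \<and> compact K}. emeasure (marginal R) K)"
      by (rule inner_regular) (auto simp: sP P.emeasure_eq_measure)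
    \<comment> \<open>\<open>ennreal\<close> sends negative numbers to 0, so the strict inequality
      fails if \<open>A\<close> has mass 0; the empty set serves in that case.\<close>
    moreover have "ennreal (measure (marginal R) A - inverse (real (Suc k))) < emeasure (marginal R) A"
      if "measure (marginal R) A \<noteq> 0"
      using that
      by (auto simp: P.emeasure_eq_measure zero_less_measure_iff simp del: of_nat_Suc intro!: ennreal_lessI)
    ultimately have "\<exists>K. compact K \<and> K \<subseteq> A \<and>
        ennreal (measure (marginal R) A - inverse (real (Suc k))) < emeasure (marginal R) K"
      if "measure (marginal R) A \<noteq> 0"
      using that by (auto simp: less_SUP_iff simp del: of_nat_Suc)
    then have "\<exists>K. compact K \<and> K \<subseteq> A \<and>
        measure (marginal R) A - inverse (real (Suc k)) < measure (marginal R) K"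
      if "measure (marginal R) A \<noteq> 0"
      using that unfolding P.emeasure_eq_measure by (meson ennreal_leI not_less)
    then show ?thesis
      by (cases "measure (marginal R) A = 0") (auto intro!: exI[of _ "{}"] simp del: of_nat_Suc)
  qed
  then obtain C where C: "\<And>k. compact (C k)" "\<And>k. C k \<subseteq> A"
    "\<And>k. measure (marginal R) A - inverse (real (Suc k)) < measure (marginal R) (C k)"
    by metis
  have [simp]: "C k \<in> sets borel" for k
    using C(1) by (simp add: borel_compact)
  have [simp]: "A - C k \<in> sets borel" for k
    by (intro sets.Diff) simp_all
  have "(\<lambda>k. measure R (C k \<times> B)) \<longlonglongrightarrow> measure R (A \<times> B)" if B [simp]: "B \<in> sets borel" for B
  proof (rule tendsto_sandwich)
    have "measure R (A \<times> B) \<le> measure R (C k \<times> B) + inverse (real (Suc k))" for k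
    proof -
      have "measure R (A \<times> B) \<le> measure R (C k \<times> B \<union> (A - C k) \<times> UNIV)"
        by (intro finite_measure_mono) auto
      also have "\<dots> \<le> measure R (C k \<times> B) + measure R ((A - C k) \<times> UNIV)"
        by (intro measure_subadditive) (auto simp: emeasure_eq_measure)
      also have "(A - C k) \<times> UNIV = A \<times> UNIV - C k \<times> UNIV" by auto
      also have "measure R \<dots> = measure R (A \<times> UNIV) - measure R (C k \<times> UNIV)"
        using C(2)[of k] by (intro finite_measure_Diff) auto
      finally show ?thesis
        using C(3)[of k] by (simp add: measure_marginal del: of_nat_Suc)
    qed
    then show "eventually (\<lambda>k. measure R (A \<times> B) - inverse (real (Suc k)) \<le> measure R (C k \<times> B)) sequentially"
      by (intro always_eventually) (simp add: diff_le_eq del: of_nat_Suc)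
    show "eventually (\<lambda>k. measure R (C k \<times> B) \<le> measure R (A \<times> B)) sequentially"
      by (intro always_eventually allI finite_measure_mono) (use C(2) in auto)
    show "(\<lambda>k. measure R (A \<times> B) - inverse (real (Suc k))) \<longlonglongrightarrow> measure R (A \<times> B)"
      using tendsto_diff[OF tendsto_const LIMSEQ_inverse_real_of_nat] by simp
  qed simp
  with C that show ?thesis by blast
qed

text \<open>The strict sublevel set is open and hence interior, which leaves only the level set.
  Enlarging \<open>C\<close> by an uncharged level \<open>t\<close> therefore gives a continuity
  set.\<close>

lemma frontier_infdist_le_subset: "frontier {x. infdist x C \<le> t} \<subseteq> {x. infdist x C = t}"
proof -
  have cl: "closed {x. infdist x C \<le> t}" and op: "open {x. infdist x C < t}"
    by (auto intro!: closed_Collect_le open_Collect_less continuous_intros)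
  have "{x. infdist x C < t} \<subseteq> interior {x. infdist x C \<le> t}"
    by (rule interior_maximal[OF _ op]) auto
  with cl show ?thesis
    by (auto simp: frontier_def closure_closed) (meson le_less subsetD mem_Collect_eq)
qed

text \<open>A point outside a nonempty closed set has positive distance to it, and
  \<open>d k\<close> eventually drops below that distance.\<close>

lemma infdist_le_tendsto_closed:
  assumes "closed C" "C \<noteq> {}" "\<And>k :: nat. 0 < d k" "d \<longlonglongrightarrow> 0"
  shows "eventually (\<lambda>k. infdist x C \<le> d k \<longleftrightarrow> x \<in> C) sequentially"
proof (cases "x \<in> C")
  case True
  then show ?thesis using assms(3) by (simp add: less_imp_le)
next
  case False
  then have "0 < infdist x C"
    using assms by (intro infdist_pos_not_in_closed) auto
  then have "eventually (\<lambda>k. d k < infdist x C) sequentially"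
    using assms(4) by (rule order_tendstoD(2)[rotated])
  then show ?thesis
    by eventually_elim (use False in auto)
qed

text \<open>Three limits are taken in turn: \<open>n\<close> tends to infinity on fixed enlargements
  of compact sets, then the radii of the enlargements shrink to 0, and finally compact sets exhaust
  the given Borel sets.\<close>

lemma stoch_ordered_weak_limit:
  assumes Rn: "\<And>n. plane_law (Rn n)" and R: "plane_law R"
    and conv: "weakly_converges Rn R" and ord: "\<And>n. stoch_ordered (Rn n)"
  shows "stoch_ordered R"
proof -
  interpret plane_law R by fact
  interpret Rn: plane_law "Rn n" for n by fact
  have cset: "(\<lambda>n. measure (Rn n) A) \<longlonglongrightarrow> measure R A"
    if "A \<in> sets borel" "measure R (frontier A) = 0" for A
    using that Rn.prob_space_axioms prob_space_axioms conv
    by (intro weakly_converges_continuity_set) auto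
  have compact_case: "measure R (C1 \<times> {y<..}) * measure R (C2 \<times> UNIV)
      \<le> measure R (C1 \<times> UNIV) * measure R (C2 \<times> {y<..})"
    if C: "compact C1" "compact C2" and less: "\<forall>a\<in>C1. \<forall>b\<in>C2. a < b" for C1 C2 y
  \<comment> \<open>Distances to the empty set are 0 by convention, so the enlargements below make
    sense for nonempty sets only.\<close>
  proof (cases "C1 = {} \<or> C2 = {}")
    case True
    then show ?thesis by auto
  next
    case False
    then have ne: "C1 \<noteq> {}" "C2 \<noteq> {}" by auto
    obtain s1 where s1: "s1 \<in> C1" "\<And>c. c \<in> C1 \<Longrightarrow> c \<le> s1"
      using compact_attains_sup[OF C(1) ne(1)] by auto
    obtain s2 where s2: "s2 \<in> C2" "\<And>c. c \<in> C2 \<Longrightarrow> s2 \<le> c"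
      using compact_attains_inf[OF C(2) ne(2)] by auto
    have gap: "s1 < s2" using less s1 s2 by auto
    define g1 g2 h :: "real \<times> real \<Rightarrow> real"
      where "g1 z = infdist (fst z) C1" and "g2 z = infdist (fst z) C2" and "h z = snd z - y" for z
    have g_meas: "g1 \<in> borel_measurable R" "g2 \<in> borel_measurable R" "h \<in> borel_measurable R"
      unfolding measurable_cong_sets[OF sets_R refl] g1_def g2_def h_def
      by (intro borel_measurable_continuous_onI continuous_intros)+
    \<comment> \<open>The three exceptional sets are joined so that the same \<open>d k\<close> can
      enlarge both compact sets and shift the height \<open>y\<close>.\<close>
    have "countable ({t. measure R {z \<in> space R. g1 z = t} \<noteq> 0}
        \<union> {t. measure R {z \<in> space R. g2 z = t} \<noteq> 0} \<union> {t. measure R {z \<in> space R. h z = t} \<noteq> 0})"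
      by (intro countable_Un countable_level_support g_meas)
    then obtain d where d: "\<And>k. 0 < d k" "d \<longlonglongrightarrow> 0"
      and d0: "\<And>k. measure R {z. g1 z = d k} = 0" "\<And>k. measure R {z. g2 z = d k} = 0"
        "\<And>k. measure R {z. h z = d k} = 0"
      by (rule countable_avoiding_null_sequence) auto
    define D1 D2 where "D1 k = {x. infdist x C1 \<le> d k}" and "D2 k = {x. infdist x C2 \<le> d k}" for k
    have D_closed: "closed (D1 k)" "closed (D2 k)" for k
      unfolding D1_def D2_def by (intro closed_Collect_le continuous_intros)+
    then have D_borel [simp]: "D1 k \<in> sets borel" "D2 k \<in> sets borel" for k
      by (simp_all add: borel_closed)
    have level_borel: "{z. g1 z = t} \<in> sets borel" "{z. g2 z = t} \<in> sets borel" for t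
      unfolding g1_def g2_def by (intro borel_closed closed_Collect_eq continuous_intros)+
    have D1_null: "measure R (frontier (D1 k) \<times> UNIV) = 0" for k
    proof -
      have "measure R (frontier (D1 k) \<times> UNIV) \<le> measure R {z. g1 z = d k}"
        using frontier_infdist_le_subset[of C1 "d k"] level_borel
        by (intro finite_measure_mono) (auto simp: D1_def g1_def)
      then show ?thesis by (simp add: d0 measure_le_0_iff)
    qed
    have D2_null: "measure R (frontier (D2 k) \<times> UNIV) = 0" for k
    proof -
      have "measure R (frontier (D2 k) \<times> UNIV) \<le> measure R {z. g2 z = d k}"
        using frontier_infdist_le_subset[of C2 "d k"] level_borel
        by (intro finite_measure_mono) (auto simp: D2_def g2_def)
      then show ?thesis by (simp add: d0 measure_le_0_iff)
    qed
    have y_null: "measure R (UNIV \<times> frontier {y + d k<..}) = 0" for k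
    proof -
      have "UNIV \<times> frontier {y + d k<..} = {z. h z = d k}"
        by (auto simp: frontier_def h_def interior_open)
      then show ?thesis using d0 by simp
    qed
    \<comment> \<open>A radius below half of the gap keeps \<open>D1 k\<close> to the left of
      \<open>D2 k\<close>, so the order of every \<open>Rn n\<close> applies. All four rectangles
      are continuity sets of \<open>R\<close>, and the inequality passes to the limit.\<close>
    have ineq_d: "measure R (D1 k \<times> {y + d k<..}) * measure R (D2 k \<times> UNIV)
        \<le> measure R (D1 k \<times> UNIV) * measure R (D2 k \<times> {y + d k<..})"
      if k: "d k < (s2 - s1) / 2" for k
    proof (rule LIMSEQ_le)
      show "(\<lambda>n. measure (Rn n) (D1 k \<times> {y + d k<..}) * measure (Rn n) (D2 k \<times> UNIV))
          \<longlonglongrightarrow> measure R (D1 k \<times> {y + d k<..}) * measure R (D2 k \<times> UNIV)"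
        by (intro tendsto_mult cset measure_frontier_Times D1_null D2_null y_null) auto
      show "(\<lambda>n. measure (Rn n) (D1 k \<times> UNIV) * measure (Rn n) (D2 k \<times> {y + d k<..}))
          \<longlonglongrightarrow> measure R (D1 k \<times> UNIV) * measure R (D2 k \<times> {y + d k<..})"
        by (intro tendsto_mult cset measure_frontier_Times D1_null D2_null y_null) auto
      have "a < b" if a: "a \<in> D1 k" and b: "b \<in> D2 k" for a b
      proof -
        obtain c1 where "c1 \<in> C1" "infdist a C1 = dist a c1"
          using infdist_attains_inf[OF compact_imp_closed[OF C(1)] ne(1)] by blast
        then have "a \<le> s1 + d k"
          using a s1(2)[of c1] by (auto simp: D1_def dist_real_def)
        moreover obtain c2 where "c2 \<in> C2" "infdist b C2 = dist b c2"
          using infdist_attains_inf[OF compact_imp_closed[OF C(2)] ne(2)] by blast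
        then have "s2 - d k \<le> b"
          using b s2(2)[of c2] by (auto simp: D2_def dist_real_def)
        ultimately show ?thesis using k by simp
      qed
      then show "\<exists>N. \<forall>n\<ge>N. measure (Rn n) (D1 k \<times> {y + d k<..}) * measure (Rn n) (D2 k \<times> UNIV)
          \<le> measure (Rn n) (D1 k \<times> UNIV) * measure (Rn n) (D2 k \<times> {y + d k<..})"
        using ord Rn.stoch_ordered_iff by auto
    qed
    note y_ev = null_sequence_add_less[OF d, of y]
    have C_closed: "closed C1" "closed C2"
      using C by (auto intro: compact_imp_closed)
    then have C_borel [simp]: "C1 \<in> sets borel" "C2 \<in> sets borel"
      by (simp_all add: borel_closed)
    have D1_ev: "eventually (\<lambda>k. x \<in> D1 k \<longleftrightarrow> x \<in> C1) sequentially" for x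
      using infdist_le_tendsto_closed[OF C_closed(1) ne(1) d] by (simp add: D1_def)
    have D2_ev: "eventually (\<lambda>k. x \<in> D2 k \<longleftrightarrow> x \<in> C2) sequentially" for x
      using infdist_le_tendsto_closed[OF C_closed(2) ne(2) d] by (simp add: D2_def)
    have D_lim: "(\<lambda>k. measure R (D1 k \<times> UNIV)) \<longlonglongrightarrow> measure R (C1 \<times> UNIV)"
      "(\<lambda>k. measure R (D2 k \<times> UNIV)) \<longlonglongrightarrow> measure R (C2 \<times> UNIV)"
      "(\<lambda>k. measure R (D1 k \<times> {y + d k<..})) \<longlonglongrightarrow> measure R (C1 \<times> {y<..})"
      "(\<lambda>k. measure R (D2 k \<times> {y + d k<..})) \<longlonglongrightarrow> measure R (C2 \<times> {y<..})"
      by (rule measure_Times_tendsto; use D1_ev D2_ev y_ev in simp)+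
    show ?thesis
    proof (rule tendsto_le[OF sequentially_bot])
      show "(\<lambda>k. measure R (D1 k \<times> {y + d k<..}) * measure R (D2 k \<times> UNIV))
          \<longlonglongrightarrow> measure R (C1 \<times> {y<..}) * measure R (C2 \<times> UNIV)"
        and "(\<lambda>k. measure R (D1 k \<times> UNIV) * measure R (D2 k \<times> {y + d k<..}))
          \<longlonglongrightarrow> measure R (C1 \<times> UNIV) * measure R (C2 \<times> {y<..})"
        by (intro tendsto_mult D_lim)+
      have "eventually (\<lambda>k. d k < (s2 - s1) / 2) sequentially"
        using d(2) gap by (intro order_tendstoD(2)) auto
      then show "eventually (\<lambda>k. measure R (D1 k \<times> {y + d k<..}) * measure R (D2 k \<times> UNIV)
          \<le> measure R (D1 k \<times> UNIV) * measure R (D2 k \<times> {y + d k<..})) sequentially"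
        by eventually_elim (rule ineq_d)
    qed
  qed
  show ?thesis
    unfolding stoch_ordered_iff
  proof (intro allI ballI impI)
    fix y :: real and A1 A2 :: "real set"
    assume A: "A1 \<in> sets borel" "A2 \<in> sets borel" and less: "\<forall>a\<in>A1. \<forall>b\<in>A2. a < b"
    obtain C1 where C1: "\<And>k :: nat. compact (C1 k)" "\<And>k. C1 k \<subseteq> A1"
      "\<And>B. B \<in> sets borel \<Longrightarrow> (\<lambda>k. measure R (C1 k \<times> B)) \<longlonglongrightarrow> measure R (A1 \<times> B)"
      using compact_inner_approximation[OF A(1)] by blast
    obtain C2 where C2: "\<And>k :: nat. compact (C2 k)" "\<And>k. C2 k \<subseteq> A2"
      "\<And>B. B \<in> sets borel \<Longrightarrow> (\<lambda>k. measure R (C2 k \<times> B)) \<longlonglongrightarrow> measure R (A2 \<times> B)"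
      using compact_inner_approximation[OF A(2)] by blast
    show "measure R (A1 \<times> {y<..}) * measure R (A2 \<times> UNIV)
      \<le> measure R (A1 \<times> UNIV) * measure R (A2 \<times> {y<..})"
    proof (rule LIMSEQ_le)
      show "(\<lambda>k. measure R (C1 k \<times> {y<..}) * measure R (C2 k \<times> UNIV))
          \<longlonglongrightarrow> measure R (A1 \<times> {y<..}) * measure R (A2 \<times> UNIV)"
        and "(\<lambda>k. measure R (C1 k \<times> UNIV) * measure R (C2 k \<times> {y<..}))
          \<longlonglongrightarrow> measure R (A1 \<times> UNIV) * measure R (A2 \<times> {y<..})"
        by (intro tendsto_mult C1(3) C2(3); simp)+
      show "\<exists>N. \<forall>n\<ge>N. measure R (C1 n \<times> {y<..}) * measure R (C2 n \<times> UNIV)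
          \<le> measure R (C1 n \<times> UNIV) * measure R (C2 n \<times> {y<..})"
        using compact_case C1(1,2) C2(1,2) less by (meson subsetD)
    qed
  qed
qed

section \<open>The extremal kernel and its quantiles\<close>

text \<open>\<open>1 - T\<close> is a distribution function: \<open>interval_measure\<close> gives
  existence and \<open>cdf_unique\<close> uniqueness. Both are required to evaluate the definite
  descriptions of the extremal kernels.\<close>

lemma ex1_real_distribution_tail:
  fixes T :: "real \<Rightarrow> real"
  assumes mono: "\<And>y z. y \<le> z \<Longrightarrow> T z \<le> T y" and right: "\<And>y. continuous (at_right y) T"
    and top: "(T \<longlongrightarrow> 0) at_top" and bot: "(T \<longlongrightarrow> 1) at_bot"
  shows "\<exists>!M. prob_space M \<and> sets M = sets borel \<and> (\<forall>y. measure M {y<..} = T y)"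
proof -
  have tail: "measure M {y<..} = 1 - measure M {..y}" if "prob_space M" "sets M = sets borel" for M and y :: real
  proof -
    interpret prob_space M by fact
    have "space M = UNIV" using that by (metis sets_eq_imp_space_eq space_borel)
    then have "{y<..} = space M - {..y}" by auto
    then show ?thesis using that by (simp add: prob_compl)
  qed
  let ?F = "\<lambda>y. 1 - T y"
  have F: "\<And>y z. y \<le> z \<Longrightarrow> ?F y \<le> ?F z" "\<And>y. continuous (at_right y) ?F"
    "(?F \<longlongrightarrow> 0) at_bot" "(?F \<longlongrightarrow> 1) at_top"
    using mono right tendsto_diff[OF tendsto_const top, of 1] tendsto_diff[OF tendsto_const bot, of 1]
    by (auto intro!: continuous_intros)
  interpret I: real_distribution "interval_measure ?F"
    by (rule real_distribution_interval_measure) (use F in auto)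
  have cdf_I: "cdf (interval_measure ?F) = ?F"
    by (rule cdf_interval_measure) (use F in auto)
  show ?thesis
  proof (rule ex1I[of _ "interval_measure ?F"])
    show "prob_space (interval_measure ?F) \<and> sets (interval_measure ?F) = sets borel
        \<and> (\<forall>y. measure (interval_measure ?F) {y<..} = T y)"
      using I.prob_space_axioms tail[of "interval_measure ?F"] cdf_I by (simp add: cdf_def fun_eq_iff)
    fix M assume M: "prob_space M \<and> sets M = sets borel \<and> (\<forall>y. measure M {y<..} = T y)"
    then have "real_distribution M"
      by (auto simp: real_distribution_def real_distribution_axioms_def)
    moreover have "cdf M = ?F"
      using M tail[of M] by (auto simp: cdf_def fun_eq_iff algebra_simps)
    ultimately show "M = interval_measure ?F"
      using cdf_I I.real_distribution_axioms by (intro cdf_unique) auto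
  qed
qed

text \<open>The limits of the distribution function at both ends make the set of admissible
  \<open>y\<close> nonempty and bounded below; right continuity puts its infimum into the
  set.\<close>

lemma cdf_quantile_set_has_least:
  assumes "real_distribution M" and \<beta>: "0 < \<beta>" "\<beta> < 1"
  obtains m where "\<And>y. \<beta> \<le> measure M {..y} \<longleftrightarrow> m \<le> y"
proof -
  interpret real_distribution M by fact
  let ?S = "{y. \<beta> \<le> cdf M y}"
  have "eventually (\<lambda>y. \<beta> < cdf M y) at_top"
    using \<beta> by (intro order_tendstoD(1)[OF cdf_lim_at_top_prob])
  then have ne: "?S \<noteq> {}"
    by (auto simp: eventually_at_top_linorder dest: less_imp_le)
  have "eventually (\<lambda>y. cdf M y < \<beta>) at_bot"
    using \<beta> by (intro order_tendstoD(2)[OF cdf_lim_at_bot])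
  then obtain l where l: "\<And>y. y \<le> l \<Longrightarrow> cdf M y < \<beta>"
    by (auto simp: eventually_at_bot_linorder)
  have bdd: "bdd_below ?S"
    by (rule bdd_belowI[of _ l]) (use l in \<open>force simp: not_less[symmetric]\<close>)
  have above: "\<beta> \<le> cdf M y" if "Inf ?S < y" for y
  proof -
    obtain s where "s \<in> ?S" "s < y"
      using cInf_lessD[OF ne \<open>Inf ?S < y\<close>] by auto
    then show ?thesis
      using cdf_nondecreasing[of s y] by simp
  qed
  have "\<beta> \<le> cdf M (Inf ?S)"
  proof (rule tendsto_lowerbound)
    show "(cdf M \<longlongrightarrow> cdf M (Inf ?S)) (at_right (Inf ?S))"
      using cdf_is_right_cont[of "Inf ?S"] by (simp add: continuous_within)
    show "eventually (\<lambda>y. \<beta> \<le> cdf M y) (at_right (Inf ?S))"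
      unfolding eventually_at_right_field by (intro exI[of _ "Inf ?S + 1"]) (simp add: above)
  qed simp
  then have "\<beta> \<le> cdf M y \<longleftrightarrow> Inf ?S \<le> y" for y
    using cdf_nondecreasing[of "Inf ?S" y] cInf_lower[OF _ bdd, of y] by (meson mem_Collect_eq order.trans)
  then show ?thesis
    unfolding cdf_def by (rule that)
qed

section \<open>Tails, existence and quantiles of \<open>kernel_w\<close>\<close>

context plane_law
begin

lemma dist_range_iff:
  "x \<in> dist_range R \<longleftrightarrow> 0 < measure R ({..x} \<times> UNIV) \<and> 0 < measure R ({x..} \<times> UNIV)"
  by (simp add: dist_range_def measure_marginal)

lemma tail_ratio_at_top:
  assumes A: "A \<in> sets borel"
  shows "(\<lambda>k. measure R (A \<times> {real k<..}) / c) \<longlonglongrightarrow> 0"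
proof -
  have "eventually (\<lambda>k. y \<in> {real k<..} \<longleftrightarrow> y \<in> {}) sequentially" for y
    using eventually_ge_at_top[of "nat \<lceil>y\<rceil>"] by eventually_elim (auto; linarith)
  then have "(\<lambda>k. measure R (A \<times> {real k<..})) \<longlonglongrightarrow> measure R (A \<times> {})"
    using A by (intro measure_Times_tendsto) simp_all
  then show ?thesis
    using tendsto_divide_zero by auto
qed

lemma tail_ratio_at_bot:
  assumes A: "A \<in> sets borel"
  shows "(\<lambda>k. measure R (A \<times> {- real k<..}) / c) \<longlonglongrightarrow> measure R (A \<times> UNIV) / c"
proof -
  have "eventually (\<lambda>k. y \<in> {- real k<..} \<longleftrightarrow> y \<in> UNIV) sequentially" for y
    using eventually_gt_at_top[of "nat \<lceil>- y\<rceil>"] by eventually_elim (auto; linarith)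
  then have "(\<lambda>k. measure R (A \<times> {- real k<..})) \<longlonglongrightarrow> measure R (A \<times> UNIV)"
    using A by (intro measure_Times_tendsto) simp_all
  then show ?thesis
    unfolding divide_inverse by (intro tendsto_mult_right)
qed

lemma tail_ratio_right:
  assumes A: "A \<in> sets borel"
  shows "(\<lambda>k. measure R (A \<times> {y + inverse (real (Suc k))<..}) / c) \<longlonglongrightarrow> measure R (A \<times> {y<..}) / c"
proof -
  have "eventually (\<lambda>k. t \<in> {y + inverse (real (Suc k))<..} \<longleftrightarrow> t \<in> {y<..}) sequentially" for t
    using null_sequence_add_less[OF _ LIMSEQ_inverse_real_of_nat, of y t] by simp
  then have "(\<lambda>k. measure R (A \<times> {y + inverse (real (Suc k))<..})) \<longlonglongrightarrow> measure R (A \<times> {y<..})"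
    using A by (intro measure_Times_tendsto) simp_all
  then show ?thesis
    unfolding divide_inverse by (intro tendsto_mult_right)
qed

text \<open>The set is the one in \<open>kernel_w_def\<close>, so that the definition can be folded
  there; \<open>left_tail_eq\<close> turns it into an indexed supremum of ratios of
  \<open>R\<close>-masses.\<close>

definition left_tail :: "real \<Rightarrow> real \<Rightarrow> real" where
  "left_tail x y = Sup {measure R ({a<..x} \<times> {y<..}) / measure (marginal R) {a<..x} | a.
             a < x \<and> measure (marginal R) {a<..x} > 0}"

lemma left_tail_eq:
  "left_tail x y = (SUP a\<in>{a. a < x \<and> 0 < measure R ({a<..x} \<times> UNIV)}.
      measure R ({a<..x} \<times> {y<..}) / measure R ({a<..x} \<times> UNIV))"
  unfolding left_tail_def by (rule arg_cong[of _ _ Sup]) (auto simp: measure_marginal)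

text \<open>The bound 1 also covers intervals of mass 0, where the ratio is 0 by the convention for
  division; hence \<open>S\<close> is arbitrary.\<close>

lemma left_ratio_bdd_above:
  "bdd_above ((\<lambda>a. measure R ({a<..x} \<times> {y<..}) / measure R ({a<..x} \<times> UNIV)) ` S)"
proof (rule bdd_aboveI2[where M=1])
  show "measure R ({a<..x} \<times> {y<..}) / measure R ({a<..x} \<times> UNIV) \<le> 1" for a
    using finite_measure_mono[of "{a<..x} \<times> {y<..}" "{a<..x} \<times> UNIV"]
    by (intro divide_le_eq_1[THEN iffD2]) (auto simp: zero_less_measure_iff)
qed

text \<open>The intervals \<open>{x - real (Suc k)<..x}\<close> increase to \<open>{..x}\<close>,
  which is charged. Thus the supremum in \<open>left_tail\<close> runs over a nonempty set.\<close>

lemma left_interval_positive: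
  assumes "x \<in> dist_range R"
  obtains a where "a < x" "0 < measure R ({a<..x} \<times> UNIV)"
proof -
  have "eventually (\<lambda>k. t \<in> {x - real (Suc k)<..x} \<longleftrightarrow> t \<in> {..x}) sequentially" for t
    using eventually_ge_at_top[of "nat \<lceil>x - t\<rceil>"] by eventually_elim (auto; linarith)
  then have "(\<lambda>k. measure R ({x - real (Suc k)<..x} \<times> UNIV)) \<longlonglongrightarrow> measure R ({..x} \<times> UNIV)"
    by (intro measure_Times_tendsto) simp_all
  moreover have "0 < measure R ({..x} \<times> UNIV)"
    using assms dist_range_iff by auto
  ultimately have "eventually (\<lambda>k. 0 < measure R ({x - real (Suc k)<..x} \<times> UNIV)) sequentially"
    by (rule order_tendstoD(1))
  then obtain k where "0 < measure R ({x - real (Suc k)<..x} \<times> UNIV)"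
    by (auto dest: eventually_happens)
  then show ?thesis
    using that[of "x - real (Suc k)"] by simp
qed

text \<open>Keeps the mass of the suprema of the ratios from escaping to \<open>\<infinity>\<close>.\<close>

lemma left_ratio_le_right_ratio:
  assumes ord: "stoch_ordered R" and x: "a < x"
  shows "measure R ({a<..x} \<times> {y<..}) * measure R ({x..} \<times> UNIV)
    \<le> measure R ({a<..x} \<times> UNIV) * measure R ({x..} \<times> {y<..})"
proof -
  \<comment> \<open>The two intervals share the point \<open>x\<close>, so the order does not apply
    to them directly. Cutting both at \<open>x\<close> gives three ordered pairs of sets, and the
    product of \<open>{x}\<close> with itself is the same on both sides.\<close>
  have split: "measure R ({a<..x} \<times> B) = measure R ({a<..<x} \<times> B) + measure R ({x} \<times> B)"
    "measure R ({x..} \<times> B) = measure R ({x} \<times> B) + measure R ({x<..} \<times> B)"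
    if "B \<in> sets borel" for B
    using that x by (subst finite_measure_Union[symmetric]; auto intro!: arg_cong[of _ _ "measure R"])+
  have "measure R (A \<times> {y<..}) * measure R (B \<times> UNIV) \<le> measure R (A \<times> UNIV) * measure R (B \<times> {y<..})"
    if "A \<in> sets borel" "B \<in> sets borel" "\<forall>a\<in>A. \<forall>b\<in>B. a < b" for A B
    using ord that by (simp add: stoch_ordered_iff)
  from this[of "{a<..<x}" "{x}"] this[of "{a<..<x}" "{x<..}"] this[of "{x}" "{x<..}"]
  show ?thesis
    by (simp add: split algebra_simps)
qed

text \<open>A supremum of decreasing, right continuous ratios is again decreasing and right
  continuous. A single ratio gives the limit 1 at the bottom; the limit 0 at the top comes from a
  majorant common to all \<open>a\<close>.\<close>

lemma kernel_w_law:
  assumes ord: "stoch_ordered R" and x: "x \<in> dist_range R"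
  shows "\<exists>!M. prob_space M \<and> sets M = sets borel \<and> (\<forall>y. measure M {y<..} = left_tail x y)"
proof (rule ex1_real_distribution_tail)
  let ?S = "{a. a < x \<and> 0 < measure R ({a<..x} \<times> UNIV)}"
  let ?r = "\<lambda>a y. measure R ({a<..x} \<times> {y<..}) / measure R ({a<..x} \<times> UNIV)"
  note T = left_tail_eq[of x]
  obtain a0 where a0: "a0 \<in> ?S"
    using left_interval_positive[OF x] by blast
  have ge: "?r a y \<le> left_tail x y" if "a \<in> ?S" for a y
    unfolding T by (rule cSUP_upper[OF that left_ratio_bdd_above])
  have le: "left_tail x y \<le> c" if "\<And>a. a \<in> ?S \<Longrightarrow> ?r a y \<le> c" for y c
    unfolding T using a0 that by (intro cSUP_least) auto
  show mono: "left_tail x z \<le> left_tail x y" if "y \<le> z" for y z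
  proof (rule le)
    fix a assume a: "a \<in> ?S"
    have "?r a z \<le> ?r a y"
      using that by (intro divide_right_mono finite_measure_mono) auto
    with ge[OF a, of y] show "?r a z \<le> left_tail x y" by simp
  qed
  show "continuous (at_right y) (left_tail x)" for y
    unfolding continuous_within
  proof (rule order_tendstoI)
    fix c assume "left_tail x y < c"
    moreover have "left_tail x z \<le> left_tail x y" if "y < z" for z
      using mono that by simp
    ultimately show "eventually (\<lambda>z. left_tail x z < c) (at_right y)"
      by (auto simp: eventually_at_right_field intro!: exI[of _ "y + 1"] elim: order.strict_trans1[rotated])
  next
    \<comment> \<open>One ratio already exceeds \<open>c\<close>, and its right continuity keeps it,
      and with it the supremum, above \<open>c\<close> just to the right of
      \<open>y\<close>.\<close>
    fix c assume "c < left_tail x y"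
    then obtain a where a: "a \<in> ?S" "c < ?r a y"
      unfolding T using a0 less_cSUP_iff[OF _ left_ratio_bdd_above, of ?S c x y] by blast
    have "eventually (\<lambda>k. c < ?r a (y + inverse (real (Suc k)))) sequentially"
      by (rule order_tendstoD(1)[OF tail_ratio_right a(2)]) auto
    then obtain k where "c < ?r a (y + inverse (real (Suc k)))"
      by (auto dest: eventually_happens)
    then have k: "c < left_tail x (y + inverse (real (Suc k)))"
      using ge[OF a(1)] by (rule order.strict_trans2)
    have "c < left_tail x z" if "z < y + inverse (real (Suc k))" for z
      using k mono[of z "y + inverse (real (Suc k))"] that by linarith
    then show "eventually (\<lambda>z. c < left_tail x z) (at_right y)"
      unfolding eventually_at_right_field
      by (intro exI[of _ "y + inverse (real (Suc k))"]) (simp del: of_nat_Suc)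
  qed
  have nonneg: "0 \<le> left_tail x y" for y
    by (rule order.trans[OF _ ge[OF a0]]) simp
  have le1: "left_tail x y \<le> 1" for y
  proof (rule le)
    show "?r a y \<le> 1" if "a \<in> ?S" for a
      using that finite_measure_mono[of "{a<..x} \<times> {y<..}" "{a<..x} \<times> UNIV"] by auto
  qed
  have pos: "0 < measure R ({x..} \<times> UNIV)"
    using x dist_range_iff by auto
  \<comment> \<open>The tail ratio on \<open>{x..}\<close> does not depend on \<open>a\<close>, so
    its decay is inherited by the supremum.\<close>
  have right: "left_tail x y \<le> measure R ({x..} \<times> {y<..}) / measure R ({x..} \<times> UNIV)" for y
  proof (rule le)
    fix a assume "a \<in> ?S"
    then show "?r a y \<le> measure R ({x..} \<times> {y<..}) / measure R ({x..} \<times> UNIV)"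
      using left_ratio_le_right_ratio[OF ord, of a x y] pos by (simp add: field_simps)
  qed
  show "(left_tail x \<longlongrightarrow> 0) at_top"
  proof (rule order_tendstoI)
    fix c :: real assume "c < 0"
    then show "eventually (\<lambda>y. c < left_tail x y) at_top"
      using nonneg by (intro always_eventually) (auto intro: order.strict_trans2)
  next
    fix c :: real assume "0 < c"
    then have "eventually (\<lambda>k. measure R ({x..} \<times> {real k<..}) / measure R ({x..} \<times> UNIV) < c) sequentially"
      by (intro order_tendstoD(2)[OF tail_ratio_at_top]) auto
    then obtain k where "measure R ({x..} \<times> {real k<..}) / measure R ({x..} \<times> UNIV) < c"
      by (auto dest: eventually_happens)
    with right[of "real k"] have "left_tail x (real k) < c" by simp
    with mono show "eventually (\<lambda>y. left_tail x y < c) at_top"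
      by (auto simp: eventually_at_top_linorder intro!: exI[of _ "real k"] intro: order.strict_trans1)
  qed
  show "(left_tail x \<longlongrightarrow> 1) at_bot"
  proof (rule order_tendstoI)
    fix c :: real assume "1 < c"
    then show "eventually (\<lambda>y. left_tail x y < c) at_bot"
      using le1 by (intro always_eventually) (auto intro: order.strict_trans1)
  next
    fix c :: real assume "c < 1"
    moreover have "(\<lambda>k. ?r a0 (- real k)) \<longlonglongrightarrow> 1"
      using tail_ratio_at_bot[of "{a0<..x}" "measure R ({a0<..x} \<times> UNIV)"] a0 by simp
    ultimately have "eventually (\<lambda>k. c < ?r a0 (- real k)) sequentially"
      by (intro order_tendstoD(1)) auto
    then obtain k where "c < ?r a0 (- real k)"
      by (auto dest: eventually_happens)
    then have "c < left_tail x (- real k)"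
      using ge[OF a0] by (rule order.strict_trans2)
    with mono show "eventually (\<lambda>y. c < left_tail x y) at_bot"
      by (auto simp: eventually_at_bot_linorder intro!: exI[of _ "- real k"] intro: order.strict_trans2)
  qed
qed

lemma kernel_w_properties:
  assumes "stoch_ordered R" "x \<in> dist_range R"
  shows "real_distribution (kernel_w R x)" "measure (kernel_w R x) {y<..} = left_tail x y"
proof -
  have "prob_space (kernel_w R x) \<and> sets (kernel_w R x) = sets borel
      \<and> (\<forall>y. measure (kernel_w R x) {y<..} = left_tail x y)"
    unfolding kernel_w_def left_tail_def[symmetric] by (rule theI'[OF kernel_w_law[OF assms]])
  then show "real_distribution (kernel_w R x)" "measure (kernel_w R x) {y<..} = left_tail x y"
    by (auto simp: real_distribution_def real_distribution_axioms_def)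
qed

text \<open>Shows that the minimum in the definition is attained, and replaces statements on
  quantiles by statements on distribution functions.\<close>

lemma quantile_w_le_iff:
  assumes "stoch_ordered R" "x \<in> dist_range R" "0 < \<beta>" "\<beta> < 1"
  shows "quantile_w R \<beta> x \<le> y \<longleftrightarrow> \<beta> \<le> measure (kernel_w R x) {..y}"
proof -
  obtain m where m: "\<And>y. \<beta> \<le> measure (kernel_w R x) {..y} \<longleftrightarrow> m \<le> y"
    using cdf_quantile_set_has_least[OF kernel_w_properties(1)[OF assms(1,2)] assms(3,4)] by blast
  have "quantile_w R \<beta> x = m"
    unfolding quantile_w_def by (rule Least_equality) (simp_all add: m)
  with m show ?thesis by simp
qed

end

section \<open>The lower bound\<close>

text \<open>The set \<open>?S\<close> of bad points is closed downwards. Countably many null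
  half-lines with rational endpoints in \<open>?S\<close> cover it, except possibly for its
  maximum.\<close>

lemma AE_measure_atMost_pos:
  fixes M :: "real measure"
  assumes "finite_measure M" and [measurable_cong]: "sets M = sets borel"
  shows "AE x in M. 0 < measure M {..x}"
proof -
  interpret finite_measure M by fact
  let ?S = "{x. measure M {..x} = 0}"
  have down: "x \<in> ?S" if "x \<le> y" "y \<in> ?S" for x y
    using that finite_measure_mono[of "{..x}" "{..y}"] by (auto simp: measure_le_0_iff)
  have "AE x in M. \<forall>r\<in>\<rat> \<inter> ?S. x \<notin> {..r}"
    by (intro AE_ball_countable[THEN iffD2] ballI AE_not_in null_setsI)
       (auto simp: countable_rat emeasure_eq_measure)
  \<comment> \<open>At most one point of \<open>?S\<close> lies above all rationals of
    \<open>?S\<close>, since two such points would enclose a further rational of \<open>?S\<close>.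
    This point \<open>m\<close> belongs to the null set \<open>{..m}\<close>.\<close>
  moreover have "AE x in M. \<not> (x \<in> ?S \<and> (\<forall>r\<in>\<rat> \<inter> ?S. r < x))"
  proof (cases "\<exists>m. m \<in> ?S \<and> (\<forall>r\<in>\<rat> \<inter> ?S. r < m)")
    case True
    then obtain m where m: "m \<in> ?S" "\<forall>r\<in>\<rat> \<inter> ?S. r < m" by blast
    have "x = m" if x: "x \<in> ?S" "\<forall>r\<in>\<rat> \<inter> ?S. r < x" for x
    proof (rule ccontr)
      assume "x \<noteq> m"
      then have "min x m < max x m" by auto
      then obtain r where r: "r \<in> \<rat>" "min x m < r" "r < max x m"
        using Rats_dense_in_real by blast
      have "max x m \<in> ?S" using m x by (auto simp: max_def)
      then have "r \<in> \<rat> \<inter> ?S" using r down[of r "max x m"] by auto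
      then have "r < m" "r < x" using m(2) x(2) by blast+
      then show False using r(2) by auto
    qed
    moreover have "{..m} \<in> null_sets M"
      using m by (auto simp: emeasure_eq_measure)
    ultimately show ?thesis
      using AE_not_in[of "{..m}" M] by (auto elim!: eventually_mono)
  qed auto
  ultimately show ?thesis
    by eventually_elim (auto simp: zero_less_measure_iff not_less)
qed

section \<open>Ranges and kernels up to null sets of the marginal\<close>

context plane_law
begin

lemma finite_borel_marginal:
  "finite_measure (marginal R)" "sets (marginal R) = sets borel"
proof -
  have "fst \<in> R \<rightarrow>\<^sub>M borel"
    by (simp add: measurable_cong_sets[OF sets_R refl] borel_measurable_continuous_onI continuous_on_fst)
  then show "finite_measure (marginal R)"
    unfolding marginal_def by (rule finite_measure_distr)
qed (simp add: marginal_def)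

text \<open>Isotonicity is known on the range only; this makes it available almost everywhere. The
  condition on \<open>{x..}\<close> is the one on \<open>{..x}\<close> for the reflected
  marginal.\<close>

lemma AE_dist_range: "AE x in marginal R. x \<in> dist_range R"
proof -
  interpret P: finite_measure "marginal R" by (rule finite_borel_marginal)
  note [measurable_cong] = finite_borel_marginal(2)
  have "AE x in distr (marginal R) borel uminus. 0 < measure (distr (marginal R) borel uminus) {..x}"
    by (rule AE_measure_atMost_pos) (auto intro: P.finite_measure_distr)
  then have "AE x in marginal R. 0 < measure (distr (marginal R) borel uminus) {..- x}"
    by (rule AE_distrD[rotated]) simp
  moreover have "measure (distr (marginal R) borel uminus) {..- x} = measure (marginal R) {x..}" for x
    by (subst measure_distr) (auto intro!: arg_cong[of _ _ "measure (marginal R)"]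
        simp: sets_eq_imp_space_eq[OF finite_borel_marginal(2)])
  moreover have "AE x in marginal R. 0 < measure (marginal R) {..x}"
    by (rule AE_measure_atMost_pos) (fact finite_borel_marginal)+
  ultimately show ?thesis
    by (auto simp: dist_range_def)
qed

text \<open>Integrates a pointwise bound on the kernel over \<open>A\<close>; points outside the
  range form a null set of the marginal.\<close>

lemma stoch_kernel_bound:
  assumes K: "stoch_kernel R K" and A [measurable]: "A \<in> sets borel" and B [measurable]: "B \<in> sets borel"
    and le: "\<And>x. x \<in> A \<Longrightarrow> x \<in> dist_range R \<Longrightarrow> measure (K x) B \<le> c"
  shows "measure R (A \<times> B) \<le> c * measure R (A \<times> UNIV)"
proof -
  interpret P: finite_measure "marginal R" by (rule finite_borel_marginal)
  note [measurable_cong] = finite_borel_marginal(2)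
  have [measurable]: "K \<in> borel \<rightarrow>\<^sub>M prob_algebra borel"
    using K by (simp add: stoch_kernel_def)
  have [measurable]: "(\<lambda>x. measure (K x) B) \<in> borel_measurable borel"
    by measurable
  have K1: "measure (K x) B \<le> 1" for x
    using measurable_space[OF \<open>K \<in> borel \<rightarrow>\<^sub>M prob_algebra borel\<close>, of x]
    by (auto simp: space_prob_algebra intro: prob_space.prob_le_1)
  have "measure R (A \<times> B) = (\<integral>x. indicator A x * measure (K x) B \<partial>marginal R)"
    using K A B by (simp add: stoch_kernel_def set_lebesgue_integral_def)
  also have "\<dots> \<le> (\<integral>x. c * indicator A x \<partial>marginal R)"
  proof (rule integral_mono_AE)
    show "integrable (marginal R) (\<lambda>x. indicator A x * measure (K x) B)"
      by (rule P.integrable_const_bound[where B=1]) (auto simp: indicator_def K1)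
    show "integrable (marginal R) (\<lambda>x. c * indicator A x)"
      by (rule P.integrable_const_bound[where B="\<bar>c\<bar>"]) (auto simp: indicator_def)
    show "AE x in marginal R. indicator A x * measure (K x) B \<le> c * indicator A x"
      using AE_dist_range by eventually_elim (auto simp: indicator_def le)
  qed
  also have "\<dots> = c * measure R (A \<times> UNIV)"
    by (simp add: measure_marginal)
  finally show ?thesis .
qed

end

lemma stoch_kernel_real_distribution:
  assumes "stoch_kernel R K"
  shows "real_distribution (K x)"
  using assms measurable_space[of K borel "prob_algebra borel" x]
  by (auto simp: stoch_kernel_def space_prob_algebra real_distribution_def real_distribution_axioms_def)

text \<open>The assumption \<open>bound\<close> speaks of rectangles under \<open>Rn n\<close> and
  not of kernels. It can thus be verified for the reflected laws as well, without reflecting the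
  kernels.\<close>

lemma liminf_quantile_w:
  assumes Rn: "\<And>n. plane_law (Rn n)" and R: "plane_law R"
    and conv: "weakly_converges Rn R" and ord: "stoch_ordered R"
    and x1: "x1 \<in> dist_range R" and x12: "x1 < x2" and \<beta>: "0 < \<beta>" "\<beta> < 1"
    and bound: "eventually (\<lambda>n. \<forall>A\<in>sets borel. \<forall>c\<ge>Q n. A \<subseteq> {..<x2} \<longrightarrow>
      measure (Rn n) (A \<times> {c<..}) \<le> (1 - \<beta>) * measure (Rn n) (A \<times> UNIV)) sequentially"
  shows "ereal (quantile_w R \<beta> x1) \<le> liminf (\<lambda>n. ereal (Q n))"
proof -
  interpret plane_law R by fact
  interpret Rn: plane_law "Rn n" for n by fact
  note kw = kernel_w_properties[OF ord x1]
  interpret W: real_distribution "kernel_w R x1" by (rule kw)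
  have "eventually (\<lambda>n. c < Q n) sequentially" if c: "c < quantile_w R \<beta> x1" for c
  proof -
    have "measure (kernel_w R x1) {..c} < \<beta>"
      using c quantile_w_le_iff[OF ord x1 \<beta>, of c] by auto
    moreover have "measure (kernel_w R x1) {c<..} = 1 - measure (kernel_w R x1) {..c}"
      using W.prob_compl[of "{..c}"] by (simp add: Compl_eq_Diff_UNIV[symmetric])
    ultimately have "1 - \<beta> < left_tail x1 c"
      using kw(2)[of c] by simp
    moreover have "{a. a < x1 \<and> 0 < measure R ({a<..x1} \<times> UNIV)} \<noteq> {}"
      using left_interval_positive[OF x1] by blast
    ultimately obtain a where a: "a < x1" "0 < measure R ({a<..x1} \<times> UNIV)"
      "1 - \<beta> < measure R ({a<..x1} \<times> {c<..}) / measure R ({a<..x1} \<times> UNIV)"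
      unfolding left_tail_eq by (subst (asm) less_cSUP_iff) (auto intro: left_ratio_bdd_above)
    have fst_meas: "(\<lambda>z. fst z - t) \<in> borel_measurable R" for t
      unfolding measurable_cong_sets[OF sets_R refl]
      by (intro borel_measurable_continuous_onI continuous_intros)
    have "countable ({t. measure R {z \<in> space R. fst z - a = t} \<noteq> 0}
        \<union> {t. measure R {z \<in> space R. fst z - x1 = t} \<noteq> 0})"
      by (intro countable_Un countable_level_support fst_meas)
    then obtain d where d: "\<And>k. 0 < d k" "d \<longlonglongrightarrow> 0"
      and d0: "\<And>k. measure R {z. fst z - a = d k} = 0" "\<And>k. measure R {z. fst z - x1 = d k} = 0"
      by (rule countable_avoiding_null_sequence) auto
    \<comment> \<open>Shifting both endpoints to the right by \<open>d k\<close> makes the interval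
      open and still lets it converge to \<open>{a<..x1}\<close>. The mass of
      \<open>J k \<times> {c<..}\<close> is then bounded below as that of an open set, even if the
      level \<open>c\<close> is charged; \<open>J k \<times> UNIV\<close> is treated as a continuity
      set.\<close>
    define J where "J k = {a + d k<..<x1 + d k}" for k
    have J_borel [simp]: "J k \<in> sets borel" for k by (simp add: J_def)
    have "eventually (\<lambda>k. x \<in> J k \<longleftrightarrow> x \<in> {a<..x1}) sequentially" for x
      using null_sequence_add_less[OF d, of a x] null_sequence_less_add[OF d, of x x1]
      by eventually_elim (auto simp: J_def)
    then have lim: "(\<lambda>k. measure R (J k \<times> B)) \<longlonglongrightarrow> measure R ({a<..x1} \<times> B)"
      if "B \<in> sets borel" for B
      using that by (intro measure_Times_tendsto) simp_all
    have "(\<lambda>k. measure R (J k \<times> {c<..}) - (1 - \<beta>) * measure R (J k \<times> UNIV))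
        \<longlonglongrightarrow> measure R ({a<..x1} \<times> {c<..}) - (1 - \<beta>) * measure R ({a<..x1} \<times> UNIV)"
      by (intro tendsto_intros lim) auto
    then have "eventually (\<lambda>k. 0 < measure R (J k \<times> {c<..}) - (1 - \<beta>) * measure R (J k \<times> UNIV)) sequentially"
      by (rule order_tendstoD(1)) (use a in \<open>simp add: field_simps\<close>)
    moreover have "eventually (\<lambda>k. d k < x2 - x1) sequentially"
      using d(2) x12 by (intro order_tendstoD(2)) auto
    ultimately have "eventually (\<lambda>k. d k < x2 - x1 \<and>
        (1 - \<beta>) * measure R (J k \<times> UNIV) < measure R (J k \<times> {c<..})) sequentially"
      by eventually_elim simp
    then obtain k where k: "d k < x2 - x1" "(1 - \<beta>) * measure R (J k \<times> UNIV) < measure R (J k \<times> {c<..})"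
      by (auto dest: eventually_happens)
    \<comment> \<open>A fixed level between the two masses separates their counterparts under
      \<open>Rn n\<close> for large \<open>n\<close>.\<close>
    obtain s where s: "(1 - \<beta>) * measure R (J k \<times> UNIV) < s" "s < measure R (J k \<times> {c<..})"
      using dense[OF k(2)] by blast
    have "measure R (frontier (J k) \<times> UNIV) = 0"
    proof -
      have fr: "frontier (J k) \<times> UNIV = {z. fst z - a = d k} \<union> {z. fst z - x1 = d k}"
        using a(1) by (auto simp: J_def frontier_def interior_open)
      have "measure R (frontier (J k) \<times> UNIV)
          \<le> measure R {z. fst z - a = d k} + measure R {z. fst z - x1 = d k}"
        unfolding fr by (intro measure_subadditive)
          (auto simp: emeasure_eq_measure intro!: borel_closed closed_Collect_eq continuous_intros)
      then show ?thesis
        by (simp add: d0 measure_le_0_iff)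
    qed
    then have "(\<lambda>n. measure (Rn n) (J k \<times> UNIV)) \<longlonglongrightarrow> measure R (J k \<times> UNIV)"
      by (intro weakly_converges_continuity_set measure_frontier_Times)
         (auto simp: conv Rn.prob_space_axioms prob_space_axioms)
    then have "eventually (\<lambda>n. (1 - \<beta>) * measure (Rn n) (J k \<times> UNIV) < s) sequentially"
      by (rule order_tendstoD(2)[OF tendsto_mult_left s(1)])
    moreover have "eventually (\<lambda>n. s < measure (Rn n) (J k \<times> {c<..})) sequentially"
    proof (rule weakly_converges_open[where N=R])
      show "open (J k \<times> {c<..})" by (simp add: J_def open_Times)
    qed (simp_all add: conv s Rn.prob_space_axioms prob_space_axioms)
    ultimately show ?thesis
      using bound
    proof eventually_elim
      case (elim n)
      have "J k \<subseteq> {..<x2}" using k by (auto simp: J_def)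
      with elim have "measure (Rn n) (J k \<times> {c<..}) \<le> (1 - \<beta>) * measure (Rn n) (J k \<times> UNIV)"
        if "Q n \<le> c"
        using that by simp
      with elim show ?case by (auto simp: not_less[symmetric])
    qed
  qed
  then show ?thesis
    unfolding le_Liminf_iff
  proof (intro allI impI)
    fix y assume ev: "\<And>c. c < quantile_w R \<beta> x1 \<Longrightarrow> eventually (\<lambda>n. c < Q n) sequentially"
      and y: "y < ereal (quantile_w R \<beta> x1)"
    obtain c where "y < ereal c" "ereal c < ereal (quantile_w R \<beta> x1)"
      using ereal_dense2[OF y] by blast
    then have c: "y < ereal c" "c < quantile_w R \<beta> x1" by simp_all
    show "eventually (\<lambda>n. y < ereal (Q n)) sequentially"
      using ev[OF c(2)] by eventually_elim (use c in \<open>auto intro: order.strict_trans\<close>)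
  qed
qed

section \<open>Reflection of the plane\<close>

text \<open>Images are used instead of preimages because the simplifier evaluates
  \<open>uminus\<close> images of intervals.\<close>

lemma (in plane_law) reflect_measure:
  assumes "A \<in> sets borel" "B \<in> sets borel"
  shows "measure (distr R borel uminus) (A \<times> B) = measure R (uminus ` A \<times> uminus ` B)"
proof -
  have "uminus -` (A \<times> B) \<inter> space R = uminus ` A \<times> uminus ` B"
    by (auto simp: image_iff) (metis minus_minus)+
  then show ?thesis
    using assms by (subst measure_distr) auto
qed

lemma (in plane_law) plane_law_reflect: "plane_law (distr R borel uminus)"
  by (auto simp: plane_law_def plane_law_axioms_def intro!: prob_space_distr)

lemma (in plane_law) measure_lessThan_tendsto:
  assumes "A \<in> sets borel"
  shows "(\<lambda>k. measure R (A \<times> {..y - inverse (real (Suc k))})) \<longlonglongrightarrow> measure R (A \<times> {..<y})"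
proof (rule measure_Times_tendsto)
  fix t
  show "eventually (\<lambda>k. t \<in> {..y - inverse (real (Suc k))} \<longleftrightarrow> t \<in> {..<y}) sequentially"
    using null_sequence_less_add[OF _ LIMSEQ_inverse_real_of_nat, of y t]
    by (rule eventually_mono) (auto simp del: of_nat_Suc)
qed (use assms in auto)

text \<open>Complements in the second coordinate give the inequality for \<open>{..t}\<close>, and a
  limit \<open>t\<close> to \<open>y\<close> from below gives it for \<open>{..<y}\<close>, the
  reflection of an upper open half-line.\<close>

lemma (in plane_law) stoch_ordered_lower:
  assumes ord: "stoch_ordered R" and A [simp]: "A1 \<in> sets borel" "A2 \<in> sets borel"
    and less: "\<forall>a\<in>A1. \<forall>b\<in>A2. a < b"
  shows "measure R (A2 \<times> {..<y}) * measure R (A1 \<times> UNIV)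
    \<le> measure R (A2 \<times> UNIV) * measure R (A1 \<times> {..<y})"
proof (rule tendsto_le[OF sequentially_bot])
  let ?B = "\<lambda>k. {..y - inverse (real (Suc k))}"
  show "(\<lambda>k. measure R (A2 \<times> ?B k) * measure R (A1 \<times> UNIV))
      \<longlonglongrightarrow> measure R (A2 \<times> {..<y}) * measure R (A1 \<times> UNIV)"
    and "(\<lambda>k. measure R (A2 \<times> UNIV) * measure R (A1 \<times> ?B k))
      \<longlonglongrightarrow> measure R (A2 \<times> UNIV) * measure R (A1 \<times> {..<y})"
    by (intro tendsto_intros measure_lessThan_tendsto A)+
  have split: "measure R (A \<times> UNIV) = measure R (A \<times> {..t}) + measure R (A \<times> {t<..})"
    if "A \<in> sets borel" for A and t :: real
    using that by (subst finite_measure_Union[symmetric]) (auto intro!: arg_cong[of _ _ "measure R"])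
  have "measure R (A2 \<times> {..t}) * measure R (A1 \<times> UNIV) \<le> measure R (A2 \<times> UNIV) * measure R (A1 \<times> {..t})" for t
  proof -
    have "measure R (A1 \<times> {t<..}) * measure R (A2 \<times> UNIV) \<le> measure R (A1 \<times> UNIV) * measure R (A2 \<times> {t<..})"
      using ord A less by (simp add: stoch_ordered_iff)
    then show ?thesis
      by (simp add: split[of _ t] algebra_simps)
  qed
  then show "eventually (\<lambda>k. measure R (A2 \<times> ?B k) * measure R (A1 \<times> UNIV)
      \<le> measure R (A2 \<times> UNIV) * measure R (A1 \<times> ?B k)) sequentially"
    by simp
qed

lemma borel_uminus_image [simp]:
  fixes A :: "real set"
  assumes "A \<in> sets borel"
  shows "uminus ` A \<in> sets borel"
proof -
  have "uminus -` A \<inter> space borel \<in> sets borel"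
    using assms by (intro measurable_sets[where A=borel]) auto
  moreover have "uminus -` A \<inter> space borel = uminus ` A"
    by (auto simp: image_iff) (metis minus_minus)
  ultimately show ?thesis by simp
qed

lemma (in plane_law) stoch_ordered_reflect:
  assumes "stoch_ordered R"
  shows "stoch_ordered (distr R borel uminus)"
proof -
  interpret S: plane_law "distr R borel uminus" by (rule plane_law_reflect)
  show ?thesis
    unfolding S.stoch_ordered_iff
  proof (intro allI ballI impI)
    fix y :: real and A1 A2 :: "real set"
    assume "A1 \<in> sets borel" "A2 \<in> sets borel" "\<forall>a\<in>A1. \<forall>b\<in>A2. a < b"
    then show "measure (distr R borel uminus) (A1 \<times> {y<..}) * measure (distr R borel uminus) (A2 \<times> UNIV)
      \<le> measure (distr R borel uminus) (A1 \<times> UNIV) * measure (distr R borel uminus) (A2 \<times> {y<..})"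
      using stoch_ordered_lower[OF assms, of "uminus ` A2" "uminus ` A1" "- y"]
      by (simp add: reflect_measure)
  qed
qed

lemma weakly_converges_reflect:
  assumes Rn: "\<And>n. plane_law (Rn n)" and R: "plane_law R" and conv: "weakly_converges Rn R"
  shows "weakly_converges (\<lambda>n. distr (Rn n) borel uminus) (distr R borel uminus)"
  unfolding weakly_converges_def
proof (intro allI impI)
  fix f :: "real \<times> real \<Rightarrow> real"
  assume f: "continuous_on UNIV f" "bounded (range f)"
  then have [measurable]: "f \<in> borel_measurable borel"
    by (intro borel_measurable_continuous_onI)
  have eq: "integral\<^sup>L (distr M borel uminus) f = integral\<^sup>L M (\<lambda>z. f (- z))" if "plane_law M" for M
  proof -
    interpret plane_law M by fact
    show ?thesis by (rule integral_distr) auto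
  qed
  have "continuous_on UNIV (\<lambda>z. f (- z))"
    by (intro continuous_on_compose2[OF f(1)] continuous_intros) auto
  moreover have "bounded (range (\<lambda>z. f (- z)))"
    by (rule bounded_subset[OF f(2)]) auto
  ultimately have "(\<lambda>n. integral\<^sup>L (Rn n) (\<lambda>z. f (- z))) \<longlonglongrightarrow> integral\<^sup>L R (\<lambda>z. f (- z))"
    using conv by (simp add: weakly_converges_def)
  then show "(\<lambda>n. integral\<^sup>L (distr (Rn n) borel uminus) f) \<longlonglongrightarrow> integral\<^sup>L (distr R borel uminus) f"
    by (simp add: eq Rn R)
qed

lemma (in plane_law) dist_range_reflect:
  "- x \<in> dist_range (distr R borel uminus) \<longleftrightarrow> x \<in> dist_range R"
proof -
  interpret S: plane_law "distr R borel uminus" by (rule plane_law_reflect)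
  show ?thesis
    by (auto simp: S.dist_range_iff dist_range_iff reflect_measure)
qed

lemma measure_distr_uminus:
  assumes "sets M = sets borel" "A \<in> sets borel"
  shows "measure (distr M borel uminus) A = measure M (uminus ` (A :: real set))"
proof -
  have "space M = UNIV" using assms by (metis sets_eq_imp_space_eq space_borel)
  then have "uminus -` A \<inter> space M = uminus ` A"
    by (auto simp: image_iff) (metis minus_minus)
  then show ?thesis
    using assms by (subst measure_distr) (auto simp: measurable_cong_sets[OF assms(1) refl])
qed

lemma distr_uminus_uminus:
  assumes "sets M = sets (borel :: real measure)"
  shows "distr (distr M borel uminus) borel uminus = M"
  using assms
  by (subst distr_distr) (auto simp: comp_def measurable_cong_sets[OF assms refl] intro!: distr_id2)

text \<open>Reflection maps \<open>{x..<b}\<close> to \<open>{- b<..- x}\<close> and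
  \<open>{..<y}\<close> to \<open>{- y<..}\<close>, so the suprema that define the two kernels
  coincide. Uniqueness carries over because the reflection is an involution.\<close>

lemma (in plane_law) kernel_e_reflect:
  assumes ord: "stoch_ordered R" and x: "x \<in> dist_range R"
  shows "kernel_e R x = distr (kernel_w (distr R borel uminus) (- x)) borel uminus"
proof -
  let ?S = "distr R borel uminus"
  interpret S: plane_law ?S by (rule plane_law_reflect)
  have ordS: "stoch_ordered ?S" by (rule stoch_ordered_reflect[OF ord])
  have xS: "- x \<in> dist_range ?S" using x dist_range_reflect by simp
  interpret W: real_distribution "kernel_w ?S (- x)"
    by (rule S.kernel_w_properties[OF ordS xS])
  have tail: "Sup {measure R ({x..<b} \<times> {..<y}) / measure (marginal R) {x..<b} | b.
      b > x \<and> measure (marginal R) {x..<b} > 0} = S.left_tail (- x) (- y)" for y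
  proof -
    have "{measure R ({x..<b} \<times> {..<y}) / measure (marginal R) {x..<b} | b.
          b > x \<and> measure (marginal R) {x..<b} > 0}
        = (\<lambda>b. measure R ({x..<b} \<times> {..<y}) / measure R ({x..<b} \<times> UNIV)) `
          {b. b > x \<and> measure R ({x..<b} \<times> UNIV) > 0}"
      by (auto simp: measure_marginal)
    also have "{b. b > x \<and> measure R ({x..<b} \<times> UNIV) > 0}
        = uminus ` {a. a < - x \<and> 0 < measure R ({x..<- a} \<times> UNIV)}"
      by (auto simp: image_iff) (metis minus_less_iff minus_minus neg_less_iff_less)
    finally show ?thesis
      unfolding S.left_tail_eq by (simp add: reflect_measure image_image)
  qed
  show ?thesis
    unfolding kernel_e_def tail
  proof (rule the_equality)
    show "prob_space (distr (kernel_w ?S (- x)) borel uminus) \<and>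
      sets (distr (kernel_w ?S (- x)) borel uminus) = sets borel \<and>
      (\<forall>y. measure (distr (kernel_w ?S (- x)) borel uminus) {..<y} = S.left_tail (- x) (- y))"
      by (auto simp: measure_distr_uminus S.kernel_w_properties(2)[OF ordS xS] intro!: W.prob_space_distr)
    fix M assume M: "prob_space M \<and> sets M = sets borel \<and> (\<forall>y. measure M {..<y} = S.left_tail (- x) (- y))"
    then interpret M: prob_space M by simp
    have sM: "sets M = sets borel" using M by simp
    have meas: "uminus \<in> M \<rightarrow>\<^sub>M borel"
      unfolding measurable_cong_sets[OF sM refl] by simp
    have "prob_space (distr M borel uminus) \<and> sets (distr M borel uminus) = sets borel \<and>
      (\<forall>y. measure (distr M borel uminus) {y<..} = S.left_tail (- x) y)"
      using M M.prob_space_distr[OF meas] by (simp add: measure_distr_uminus)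
    moreover have "prob_space (kernel_w ?S (- x)) \<and> sets (kernel_w ?S (- x)) = sets borel \<and>
      (\<forall>y. measure (kernel_w ?S (- x)) {y<..} = S.left_tail (- x) y)"
      using W.prob_space_axioms S.kernel_w_properties(2)[OF ordS xS] by simp
    ultimately have "distr M borel uminus = kernel_w ?S (- x)"
      using S.kernel_w_law[OF ordS xS] by blast
    then show "M = distr (kernel_w ?S (- x)) borel uminus"
      using distr_uminus_uminus[OF sM] by simp
  qed
qed

text \<open>The reflected kernel gives \<open>{..<y}\<close> one minus the mass that
  \<open>kernel_w\<close> gives to \<open>{..- y}\<close>. Hence mass at most \<beta> on one side
  means mass at least \<open>1 - \<beta>\<close> on the other, and a greatest \<open>y\<close>
  becomes a least \<open>- y\<close>.\<close>

lemma (in plane_law) quantile_e_reflect: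
  assumes ord: "stoch_ordered R" and x: "x \<in> dist_range R" and \<beta>: "0 < \<beta>" "\<beta> < 1"
  shows "quantile_e R \<beta> x = - quantile_w (distr R borel uminus) (1 - \<beta>) (- x)"
proof -
  let ?S = "distr R borel uminus"
  interpret S: plane_law ?S by (rule plane_law_reflect)
  have ordS: "stoch_ordered ?S" by (rule stoch_ordered_reflect[OF ord])
  have xS: "- x \<in> dist_range ?S" using x dist_range_reflect by simp
  interpret W: real_distribution "kernel_w ?S (- x)"
    by (rule S.kernel_w_properties[OF ordS xS])
  have "measure (kernel_e R x) {..<y} = 1 - measure (kernel_w ?S (- x)) {..- y}" for y
    using W.prob_compl[of "{..- y}"]
    by (simp add: kernel_e_reflect[OF ord x] measure_distr_uminus Compl_eq_Diff_UNIV[symmetric])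
  then have "measure (kernel_e R x) {..<y} \<le> \<beta> \<longleftrightarrow> y \<le> - quantile_w ?S (1 - \<beta>) (- x)" for y
    using S.quantile_w_le_iff[OF ordS xS, of "1 - \<beta>" "- y"] \<beta> by auto
  then show ?thesis
    unfolding quantile_e_def by (intro Greatest_equality) auto
qed

text \<open>Complements of \<open>{t<..}\<close> order the distribution functions, and the mass of
  \<open>{..<y}\<close> is the left limit of the distribution function at \<open>y\<close>.\<close>

lemma isotonic_on_lower:
  assumes iso: "isotonic_on X K" and K: "\<And>x. real_distribution (K x)"
    and x: "x1 \<in> X" "x2 \<in> X" "x1 < x2"
  shows "measure (K x2) {..<y} \<le> measure (K x1) {..<y}"
proof -
  interpret K: real_distribution "K x" for x by (rule K)
  have "cdf (K x2) t \<le> cdf (K x1) t" for t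
  proof -
    have "measure (K x) {t<..} = 1 - cdf (K x) t" for x
      using K.prob_compl[of "{..t}" x] by (simp add: cdf_def Compl_eq_Diff_UNIV[symmetric])
    moreover have "measure (K x1) {t<..} \<le> measure (K x2) {t<..}"
      using iso x unfolding isotonic_on_def by blast
    ultimately show ?thesis by simp
  qed
  then show ?thesis
    by (intro tendsto_le[OF _ K.cdf_at_left K.cdf_at_left]) auto
qed

text \<open>An interior point has points of the range on both sides, so both open half-lines at
  \<open>x\<close> are charged by \<open>R\<close> and, being open, by \<open>Rn n\<close> for large
  \<open>n\<close>. This is what allows isotonicity of \<open>K n\<close> to be used at a fixed
  \<open>x\<close>.\<close>

lemma eventually_dist_range:
  assumes Rn: "\<And>n. plane_law (Rn n)" and R: "plane_law R"
    and conv: "weakly_converges Rn R" and x: "x \<in> interior (dist_range R)"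
  shows "eventually (\<lambda>n. x \<in> dist_range (Rn n)) sequentially"
proof -
  interpret plane_law R by fact
  interpret Rn: plane_law "Rn n" for n by fact
  obtain e where e: "e > 0" "ball x e \<subseteq> dist_range R"
    using x by (auto simp: mem_interior)
  then have "x - e / 2 \<in> dist_range R" "x + e / 2 \<in> dist_range R"
    by (auto simp: dist_real_def subset_iff)
  then have "0 < measure R ({..x - e / 2} \<times> UNIV)" "0 < measure R ({x + e / 2..} \<times> UNIV)"
    by (auto simp: dist_range_iff)
  moreover have "measure R ({..x - e / 2} \<times> UNIV) \<le> measure R ({..<x} \<times> UNIV)"
    "measure R ({x + e / 2..} \<times> UNIV) \<le> measure R ({x<..} \<times> UNIV)"
    using e by (intro finite_measure_mono; auto)+
  ultimately have pos: "0 < measure R ({..<x} \<times> UNIV)" "0 < measure R ({x<..} \<times> UNIV)"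
    by linarith+
  have "eventually (\<lambda>n. 0 < measure (Rn n) U) sequentially" if "open U" "0 < measure R U" for U
    using that by (intro weakly_converges_open[where N=R])
      (auto simp: conv Rn.prob_space_axioms prob_space_axioms)
  then have "eventually (\<lambda>n. 0 < measure (Rn n) ({..<x} \<times> UNIV)) sequentially"
    "eventually (\<lambda>n. 0 < measure (Rn n) ({x<..} \<times> UNIV)) sequentially"
    using pos by (simp_all add: open_Times)
  then show ?thesis
  proof eventually_elim
    case (elim n)
    have "measure (Rn n) ({..<x} \<times> UNIV) \<le> measure (Rn n) ({..x} \<times> UNIV)"
      "measure (Rn n) ({x<..} \<times> UNIV) \<le> measure (Rn n) ({x..} \<times> UNIV)"
      by (intro Rn.finite_measure_mono; auto)+
    with elim show ?case
      by (simp add: Rn.dist_range_iff)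
  qed
qed

theorem theorem20:
  fixes R :: "(real \<times> real) measure"
    and Rn :: "nat \<Rightarrow> (real \<times> real) measure"
    and K :: "nat \<Rightarrow> real \<Rightarrow> real measure"
    and q :: "nat \<Rightarrow> real \<Rightarrow> real \<Rightarrow> real"
  assumes "\<And>n. prob_space (Rn n)" and "\<And>n. sets (Rn n) = sets borel"
    and "prob_space R" and "sets R = sets borel"
    and "weakly_converges Rn R"
    and "\<And>n. stoch_ordered (Rn n)"
    and "\<And>n. stoch_kernel (Rn n) (K n)"
    and "\<And>n. isotonic_on (dist_range (Rn n)) (K n)"
    and "\<And>n \<beta> x. 0 < \<beta> \<Longrightarrow> \<beta> < 1 \<Longrightarrow>
           measure (K n x) {..<q n \<beta> x} \<le> \<beta> \<and> \<beta> \<le> measure (K n x) {..q n \<beta> x}"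
  shows "stoch_ordered R \<and>
    (\<forall>\<beta> x\<^sub>1 x\<^sub>2. 0 < \<beta> \<longrightarrow> \<beta> < 1 \<longrightarrow>
       x\<^sub>1 \<in> interior (dist_range R) \<longrightarrow> x\<^sub>2 \<in> interior (dist_range R) \<longrightarrow> x\<^sub>1 < x\<^sub>2 \<longrightarrow>
       liminf (\<lambda>n. ereal (q n \<beta> x\<^sub>2)) \<ge> ereal (quantile_w R \<beta> x\<^sub>1) \<and>
       limsup (\<lambda>n. ereal (q n \<beta> x\<^sub>1)) \<le> ereal (quantile_e R \<beta> x\<^sub>2))"
proof (intro conjI allI impI)
  note conv = assms(5) and kernel = assms(7) and iso = assms(8) and q = assms(9)
  have plane_R: "plane_law R" and plane_Rn: "plane_law (Rn n)" for n
    using assms(1-4) by (auto simp: plane_law_def plane_law_axioms_def)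
  interpret plane_law R by fact
  interpret Rn: plane_law "Rn n" for n by fact
  interpret K: real_distribution "K n x" for n x
    using kernel by (rule stoch_kernel_real_distribution)
  show ord: "stoch_ordered R"
    by (rule stoch_ordered_weak_limit[OF plane_Rn plane_R conv assms(6)])
  fix \<beta> x\<^sub>1 x\<^sub>2 :: real
  assume \<beta>: "0 < \<beta>" "\<beta> < 1" and x: "x\<^sub>1 \<in> interior (dist_range R)" "x\<^sub>2 \<in> interior (dist_range R)"
    and less: "x\<^sub>1 < x\<^sub>2"
  have range: "x\<^sub>1 \<in> dist_range R" "x\<^sub>2 \<in> dist_range R"
    using x interior_subset by auto
  show "ereal (quantile_w R \<beta> x\<^sub>1) \<le> liminf (\<lambda>n. ereal (q n \<beta> x\<^sub>2))"
  proof (rule liminf_quantile_w[OF plane_Rn plane_R conv ord range(1) less \<beta>])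
    show "eventually (\<lambda>n. \<forall>A\<in>sets borel. \<forall>c\<ge>q n \<beta> x\<^sub>2. A \<subseteq> {..<x\<^sub>2} \<longrightarrow>
        measure (Rn n) (A \<times> {c<..}) \<le> (1 - \<beta>) * measure (Rn n) (A \<times> UNIV)) sequentially"
      using eventually_dist_range[OF plane_Rn plane_R conv x(2)]
    proof eventually_elim
      case (elim n)
      show ?case
      proof (intro ballI allI impI)
        fix A :: "real set" and c assume A: "A \<in> sets borel" "A \<subseteq> {..<x\<^sub>2}" and c: "q n \<beta> x\<^sub>2 \<le> c"
        \<comment> \<open>Only the right half of the quantile condition enters here; the left half
          serves for the upper bound.\<close>
        have "\<beta> \<le> measure (K n x\<^sub>2) {..c}"
          using q[OF \<beta>, of n x\<^sub>2] K.finite_measure_mono[of "{..q n \<beta> x\<^sub>2}" "{..c}" n x\<^sub>2] c by simp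
        then have "measure (K n x\<^sub>2) {c<..} \<le> 1 - \<beta>"
          using K.prob_compl[of "{..c}" n x\<^sub>2] by (simp add: Compl_eq_Diff_UNIV[symmetric])
        moreover have "measure (K n t) {c<..} \<le> measure (K n x\<^sub>2) {c<..}"
          if "t \<in> A" "t \<in> dist_range (Rn n)" for t
          using iso[of n] elim that A(2) by (auto simp: isotonic_on_def)
        ultimately show "measure (Rn n) (A \<times> {c<..}) \<le> (1 - \<beta>) * measure (Rn n) (A \<times> UNIV)"
          by (intro Rn.stoch_kernel_bound[OF kernel A(1)]) (auto intro: order.trans)
      qed
    qed
  qed
  \<comment> \<open>The lower bound is applied to the reflected laws at level
    \<open>1 - \<beta>\<close>. As reflection reverses the order, \<open>- x\<^sub>2\<close> takes
    the place of the left point and \<open>- x\<^sub>1\<close> that of the right one.\<close>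
  have "ereal (quantile_w (distr R borel uminus) (1 - \<beta>) (- x\<^sub>2)) \<le> liminf (\<lambda>n. ereal (- q n \<beta> x\<^sub>1))"
  proof (rule liminf_quantile_w[where ?x2.0="- x\<^sub>1" and Rn="\<lambda>n. distr (Rn n) borel uminus"])
    show "weakly_converges (\<lambda>n. distr (Rn n) borel uminus) (distr R borel uminus)"
      by (rule weakly_converges_reflect[OF plane_Rn plane_R conv])
    show "eventually (\<lambda>n. \<forall>A\<in>sets borel. \<forall>c\<ge>- q n \<beta> x\<^sub>1. A \<subseteq> {..<- x\<^sub>1} \<longrightarrow>
        measure (distr (Rn n) borel uminus) (A \<times> {c<..})
          \<le> (1 - (1 - \<beta>)) * measure (distr (Rn n) borel uminus) (A \<times> UNIV)) sequentially"
      using eventually_dist_range[OF plane_Rn plane_R conv x(1)]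
    proof eventually_elim
      case (elim n)
      show ?case
      proof (intro ballI allI impI)
        fix A :: "real set" and c assume A: "A \<in> sets borel" "A \<subseteq> {..<- x\<^sub>1}" and c: "- q n \<beta> x\<^sub>1 \<le> c"
        have "measure (K n x\<^sub>1) {..<- c} \<le> \<beta>"
          using q[OF \<beta>, of n x\<^sub>1] K.finite_measure_mono[of "{..<- c}" "{..<q n \<beta> x\<^sub>1}" n x\<^sub>1] c by simp
        \<comment> \<open>Points of the reflected set lie to the right of \<open>x\<^sub>1\<close>,
          where the lower half-lines have smaller mass.\<close>
        moreover have "measure (K n t) {..<- c} \<le> measure (K n x\<^sub>1) {..<- c}"
          if "t \<in> uminus ` A" "t \<in> dist_range (Rn n)" for t
          using that A(2) elim by (intro isotonic_on_lower[OF iso[of n]] K.real_distribution_axioms) auto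
        ultimately have "measure (Rn n) (uminus ` A \<times> {..<- c}) \<le> \<beta> * measure (Rn n) (uminus ` A \<times> UNIV)"
          using A(1) by (intro Rn.stoch_kernel_bound[OF kernel]) (auto intro: order.trans)
        then show "measure (distr (Rn n) borel uminus) (A \<times> {c<..})
          \<le> (1 - (1 - \<beta>)) * measure (distr (Rn n) borel uminus) (A \<times> UNIV)"
          using A(1) by (simp add: Rn.reflect_measure)
      qed
    qed
  qed (use \<beta> less range ord in \<open>auto simp: plane_law_reflect Rn.plane_law_reflect dist_range_reflect
      intro: stoch_ordered_reflect\<close>)
  also have "\<dots> = - limsup (\<lambda>n. ereal (q n \<beta> x\<^sub>1))"
    using ereal_Liminf_uminus[of sequentially "\<lambda>n. ereal (q n \<beta> x\<^sub>1)"] by simp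
  finally show "limsup (\<lambda>n. ereal (q n \<beta> x\<^sub>1)) \<le> ereal (quantile_e R \<beta> x\<^sub>2)"
    unfolding quantile_e_reflect[OF ord range(2) \<beta>] uminus_ereal.simps(1)[symmetric]
    by (metis ereal_minus_le_minus ereal_uminus_uminus)
qed

end
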